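(* Let $q$ be a prime power and $n\ge 4$. The graphs $\mathcal{G}'_n$ and $\mathcal{G}''_n$ are strongly regular and have the same parameters as $\mathcal{G}_n=\mathrm{NU}(n+1,q^2)$.
   Context: A strongly regular graph with parameters $(v,k,\lambda,\mu)$ is a simple, undirected, connected graph with $v$ vertices such that each vertex lies on $k$ edges, any two adjacent vertices have exactly $\lambda$ common neighbours, and any two distinct non-adjacent vertices have exactly $\mu$ common neighbours. For a graph $\mathcal{G}$ and a vertex $u$, $N_{\mathcal{G}}(u)$ is the set of neighbours of $u$. Let $\mathcal{H}(n,q^2)$ be a non-degenerate Hermitian variety of $\mathrm{PG}(n,q^2)$ (the absolute points of a unitary polarity). A line is tangent to $\mathcal{H}(n,q^2)$ if it meets it in exactly one point. $\mathcal{G}_n=\mathrm{NU}(n+1,q^2)$ is the graph whose vertices are the points of $\mathrm{PG}(n,q^2)\setminus\mathcal{H}(n,q^2)$, two distinct vertices being adjacent if the line joining them is tangent to $\mathcal{H}(n,q^2)$. It is strongly regular with parameters $v=\frac{q^n(q^{n+1}-\epsilon)}{q+1}$, $k=(q^n+\epsilon)(q^{n-1}-\epsilon)$, $\lambda=q^{2n-3}(q+1)-\epsilon q^{n-1}(q-1)-2$, $\mu=q^{n-2}(q+1)(q^{n-1}-\epsilon)$, where $\epsilon=(-1)^{n+1}$. Fix a point $P\in\mathcal{H}(n,q^2)$ and two distinct lines $\bar\ell_1,\bar\ell_2$ with $\bar\ell_1\cap\mathcal{H}(n,q^2)=\bar\ell_2\cap\mathcal{H}(n,q^2)=\{P\}$.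 Let $\pi=\langle\bar\ell_1,\bar\ell_2\rangle$ and $\ell_i=\bar\ell_i\setminus\{P\}$, $i=1,2$. Then $\pi\cap\mathcal{H}(n,q^2)$ is either a Hermitian pencil of lines (a cone with vertex a point $V$ over a Baer subline of a line not through $V$, i.e. $q+1$ lines through $V$) or a line. Define $\mathcal{A}=\left(\bigcap_{u\in\ell_1}N_{\mathcal{G}_n}(u)\right)\cap\left(\bigcap_{u\in\ell_2}N_{\mathcal{G}_n}(u)\right)$, $\mathcal{A}_1=\left(\bigcap_{u\in\ell_1}N_{\mathcal{G}_n}(u)\right)\setminus(\mathcal{A}\cup\ell_2)$, $\mathcal{A}_2=\left(\bigcap_{u\in\ell_2}N_{\mathcal{G}_n}(u)\right)\setminus(\mathcal{A}\cup\ell_1)$. The following graph is denoted $\mathcal{G}'_n$ if $\pi\cap\mathcal{H}(n,q^2)$ is a Hermitian pencil of lines and $\mathcal{G}''_n$ if $\pi\cap\mathcal{H}(n,q^2)$ is a line: its vertices are the vertices of $\mathcal{G}_n$, and the neighbourhood of a vertex $u$ is $N_{\mathcal{G}_n}(u)$ if $u\notin\mathcal{A}_1\cup\mathcal{A}_2\cup\ell_1\cup\ell_2$; $(N_{\mathcal{G}_n}(u)\setminus\mathcal{A}_1)\cup\mathcal{A}_2$ if $u\in\ell_1$; $(N_{\mathcal{G}_n}(u)\setminus\mathcal{A}_2)\cup\mathcal{A}_1$ if $u\in\ell_2$; $(N_{\mathcal{G}_n}(u)\setminus\ell_1)\cup\ell_2$ if $u\in\mathcal{A}_1$; $(N_{\mathcal{G}_n}(u)\setminus\ell_2)\cup\ell_1$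 if $u\in\mathcal{A}_2$. *)

theory Defs
  imports
    "HOL-Analysis.Cartesian_Space"
    "HOL-Number_Theory.Prime_Powers"
    "Graph_Theory.Digraph_Component"
begin

section \<open>Strongly regular graphs\<close>

definition neighbourhood :: "'v pair_pre_digraph \<Rightarrow> 'v \<Rightarrow> 'v set" where
  "neighbourhood G u = {w. (u, w) \<in> parcs G}"

text \<open>
  A finite simple undirected graph is a \<^locale>\<open>pair_graph\<close>: no loops, no parallel arcs, and every
  edge is present as two opposite arcs.  The name \<open>connected\<close> alone could also be read as the
  topological notion, hence the qualification.
\<close>

definition strongly_regular :: "'v pair_pre_digraph \<Rightarrow> nat \<Rightarrow> nat \<Rightarrow> nat \<Rightarrow> nat \<Rightarrow> bool" where
  "strongly_regular G v k lam mu \<longleftrightarrow>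
     pair_graph G \<and> Digraph_Component.connected (with_proj G) \<and>
     card (pverts G) = v \<and>
     (\<forall>u \<in> pverts G. card (neighbourhood G u) = k) \<and>
     (\<forall>u \<in> pverts G. \<forall>w \<in> pverts G. (u, w) \<in> parcs G \<longrightarrow>
        card (neighbourhood G u \<inter> neighbourhood G w) = lam) \<and>
     (\<forall>u \<in> pverts G. \<forall>w \<in> pverts G. u \<noteq> w \<and> (u, w) \<notin> parcs G \<longrightarrow>
        card (neighbourhood G u \<inter> neighbourhood G w) = mu)"

section \<open>Projective geometry\<close>

text \<open>
  \<open>PG(n, F)\<close> is the lattice of subspaces of \<open>F ^ 'n\<close> with \<open>CARD('n) = n + 1\<close>.  Points, lines and
  planes are themselves subspaces (of vector space dimension 1, 2, 3), so incidence is inclusion;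
  \<open>points_of U\<close> is the set of points incident with \<open>U\<close>.
\<close>

definition proj_point :: "('a::field ^ 'n) set \<Rightarrow> bool" where
  "proj_point X \<longleftrightarrow> vec.subspace X \<and> vec.dim X = 1"

definition proj_line :: "('a::field ^ 'n) set \<Rightarrow> bool" where
  "proj_line L \<longleftrightarrow> vec.subspace L \<and> vec.dim L = 2"

definition points_of :: "('a::field ^ 'n) set \<Rightarrow> ('a ^ 'n) set set" where
  "points_of U = {X. proj_point X \<and> X \<subseteq> U}"

definition proj_join :: "('a::field ^ 'n) set \<Rightarrow> ('a ^ 'n) set \<Rightarrow> ('a ^ 'n) set" where
  "proj_join U W = vec.span (U \<union> W)"

section \<open>Hermitian varieties\<close>

text \<open>
  Over the field of order \<open>q\<^sup>2\<close> the involutory automorphism is \<open>x \<mapsto> x ^ q\<close>.  A unitary polarity is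
  the polarity \<open>U \<mapsto> polar B U\<close> induced by a non-degenerate Hermitian form \<open>B\<close>.
  Semilinearity of \<open>B\<close> in the second argument follows from linearity in the first one and
  the Hermitian symmetry.
\<close>

definition nondegenerate_hermitian_form ::
    "nat \<Rightarrow> ('a::field ^ 'n \<Rightarrow> 'a ^ 'n \<Rightarrow> 'a) \<Rightarrow> bool" where
  "nondegenerate_hermitian_form q B \<longleftrightarrow>
     (\<forall>y. Vector_Spaces.linear (*s) (*) (\<lambda>x. B x y)) \<and>
     (\<forall>x y. B y x = B x y ^ q) \<and>
     (\<forall>x. (\<forall>y. B x y = 0) \<longrightarrow> x = 0)"

definition polar ::
    "('a::field ^ 'n \<Rightarrow> 'a ^ 'n \<Rightarrow> 'a) \<Rightarrow> ('a ^ 'n) set \<Rightarrow> ('a ^ 'n) set" where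
  "polar B U = {y. \<forall>x \<in> U. B x y = 0}"

definition hermitian_variety ::
    "('a::field ^ 'n \<Rightarrow> 'a ^ 'n \<Rightarrow> 'a) \<Rightarrow> ('a ^ 'n) set set" where
  "hermitian_variety B = {X. proj_point X \<and> X \<subseteq> polar B X}"

definition tangent_line ::
    "('a::field ^ 'n \<Rightarrow> 'a ^ 'n \<Rightarrow> 'a) \<Rightarrow> ('a ^ 'n) set \<Rightarrow> bool" where
  "tangent_line B L \<longleftrightarrow> proj_line L \<and> card (points_of L \<inter> hermitian_variety B) = 1"

text \<open>
  A Baer subline of \<open>M\<close> consists of the points whose coordinates with respect to some basis of \<open>M\<close>
  can be taken in the subfield of order \<open>q\<close>, i.e. the fixed field of \<open>x \<mapsto> x ^ q\<close>.
\<close>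

definition baer_subline ::
    "nat \<Rightarrow> ('a::field ^ 'n) set \<Rightarrow> ('a ^ 'n) set set \<Rightarrow> bool" where
  "baer_subline q M S \<longleftrightarrow>
     (\<exists>x y. x \<noteq> y \<and> vec.independent {x, y} \<and> M = vec.span {x, y} \<and>
        S = {vec.span {a *s x + b *s y} | a b. a ^ q = a \<and> b ^ q = b \<and> (a, b) \<noteq> (0, 0)})"

definition hermitian_pencil :: "nat \<Rightarrow> ('a::field ^ 'n) set set \<Rightarrow> bool" where
  "hermitian_pencil q S \<longleftrightarrow>
     (\<exists>V M b. proj_point V \<and> proj_line M \<and> \<not> V \<subseteq> M \<and> baer_subline q M b \<and>
        S = (\<Union>R \<in> b. points_of (proj_join V R)))"

section \<open>The graph \<open>NU(n + 1, q\<^sup>2)\<close> and its switching\<close>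

definition NU_graph ::
    "('a::field ^ 'n \<Rightarrow> 'a ^ 'n \<Rightarrow> 'a) \<Rightarrow> ('a ^ 'n) set pair_pre_digraph" where
  "NU_graph B =
     (let V = points_of UNIV - hermitian_variety B
      in \<lparr> pverts = V,
           parcs = {(X, Y). X \<in> V \<and> Y \<in> V \<and> X \<noteq> Y \<and> tangent_line B (proj_join X Y)} \<rparr>)"

definition common_nbrs :: "'v pair_pre_digraph \<Rightarrow> 'v set \<Rightarrow> 'v set" where
  "common_nbrs G l = (\<Inter>u \<in> l. neighbourhood G u)"

text \<open>
  In the following, \<open>switch_set G l l'\<close> is \<open>\<A>\<^sub>1\<close> for \<open>(l, l') = (\<ell>\<^sub>1, \<ell>\<^sub>2)\<close> and \<open>\<A>\<^sub>2\<close> for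
  \<open>(l, l') = (\<ell>\<^sub>2, \<ell>\<^sub>1)\<close>.  The sets \<open>\<ell>\<^sub>1\<close>, \<open>\<ell>\<^sub>2\<close>, \<open>\<A>\<^sub>1\<close>, \<open>\<A>\<^sub>2\<close> are pairwise disjoint whenever
  \<open>\<ell>\<^sub>1\<close> and \<open>\<ell>\<^sub>2\<close> are disjoint and \<open>G\<close> has no loops, so the order of the cases in
  \<open>switched_nbhd\<close> is immaterial.
\<close>

definition switch_set :: "'v pair_pre_digraph \<Rightarrow> 'v set \<Rightarrow> 'v set \<Rightarrow> 'v set" where
  "switch_set G l l' = common_nbrs G l - ((common_nbrs G l \<inter> common_nbrs G l') \<union> l')"

definition switched_nbhd :: "'v pair_pre_digraph \<Rightarrow> 'v set \<Rightarrow> 'v set \<Rightarrow> 'v \<Rightarrow> 'v set" where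
  "switched_nbhd G l1 l2 u =
     (let A1 = switch_set G l1 l2; A2 = switch_set G l2 l1; N = neighbourhood G u in
      if u \<in> l1 then (N - A1) \<union> A2
      else if u \<in> l2 then (N - A2) \<union> A1
      else if u \<in> A1 then (N - l1) \<union> l2
      else if u \<in> A2 then (N - l2) \<union> l1
      else N)"

definition switched_graph ::
    "'v pair_pre_digraph \<Rightarrow> 'v set \<Rightarrow> 'v set \<Rightarrow> 'v pair_pre_digraph" where
  "switched_graph G l1 l2 =
     \<lparr> pverts = pverts G,
       parcs = {(u, w). u \<in> pverts G \<and> w \<in> switched_nbhd G l1 l2 u} \<rparr>"

end

theory Submission
  imports Defs "HOL-Computational_Algebra.Polynomial"
begin

text \<open>
The switching is an instance of a general principle: if the adjacency matrix \<open>A\<close> of a strongly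
regular graph is replaced by \<open>Q A Q\<close>, where \<open>Q\<close> is an orthogonal involution fixing the all-one
vector, then the identity \<open>A\<^sup>2 = k I + \<lambda> A + \<mu> (J - I - A)\<close> is preserved.  Here \<open>Q\<close> is the reflection in
the vector \<open>d\<close> that is \<open>1\<close> on \<open>\<ell>\<^sub>1\<close> and \<open>-1\<close> on \<open>\<ell>\<^sub>2\<close>.  For \<open>Q A Q\<close> to be the adjacency matrix of the
switched graph it is enough that every vertex outside \<open>\<ell>\<^sub>1 \<union> \<ell>\<^sub>2\<close> has equally many neighbours in \<open>\<ell>\<^sub>1\<close>
and \<open>\<ell>\<^sub>2\<close>, or is adjacent to all of one and none of the other, and that \<open>\<ell>\<^sub>1\<close> and \<open>\<ell>\<^sub>2\<close> induce regular
graphs of the same degree, with a constant number of edges between them.  This is Wang-Qiu-Hu switching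
(\<open>strongly_regular_switched_graph\<close>).

Geometrically, write \<open>P = \<langle>p\<rangle>\<close> with \<open>p\<close> isotropic.  A line meeting the variety in \<open>P\<close> only is orthogonal
to \<open>p\<close>, and its other points are \<open>\<langle>x + a p\<rangle>\<close> for one vector \<open>x\<close> of norm \<open>1\<close>.  Two points spanned by
vectors \<open>w\<close>, \<open>x\<close> of norm \<open>1\<close> are adjacent iff the Gram determinant of \<open>w\<close>, \<open>x\<close> vanishes, i.e. iff \<open>B w x\<close>
has field norm \<open>1\<close>.  As \<open>B w (x + a p)\<close> is \<open>B w x\<close> plus the conjugate of \<open>a\<close> times \<open>B w p\<close>, a vertex \<open>\<langle>w\<rangle>\<close>
off the two lines and not orthogonal to \<open>p\<close> has exactly \<open>q + 1\<close> neighbours on each line, and one orthogonal to \<open>p\<close> is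
adjacent to all or to none of the points of each line.  So the switching conditions hold, and the same
argument covers both shapes of the section of the variety by the plane of the two lines; they only
decide whether there are all or no edges between \<open>\<ell>\<^sub>1\<close> and \<open>\<ell>\<^sub>2\<close>.

It remains to see that the graph itself is strongly regular.  Fix a vertex \<open>\<langle>x\<rangle>\<close> with \<open>B x x = 1\<close>.  Its
neighbours are the points \<open>\<langle>x + u\<rangle>\<close> with \<open>u \<noteq> 0\<close> isotropic in the hyperplane orthogonal to \<open>x\<close>, each
obtained once (\<open>NU_neighbourhood\<close>).  Hence all parameters are numbers of isotropic vectors \<open>u\<close> of
a non-degenerate space with prescribed value \<open>B u y\<close> for a fixed \<open>y\<close>.  These follow from the number of
vectors of given norm, which obeys a recursion that splits off a non-isotropic vector
(\<open>card_by_norm\<close>).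
\<close>

section \<open>Strongly regular graphs and switching\<close>

lemma neighbourhood_iff [simp]: "w \<in> neighbourhood G u \<longleftrightarrow> (u, w) \<in> parcs G"
  by (simp add: neighbourhood_def)

lemma pair_graph_iff:
  "pair_graph G \<longleftrightarrow> finite (pverts G) \<and> parcs G \<subseteq> pverts G \<times> pverts G \<and>
     (\<forall>u w. (u, w) \<in> parcs G \<longrightarrow> (w, u) \<in> parcs G \<and> u \<noteq> w)"
proof
  assume "pair_graph G"
  then interpret pair_graph G .
  show "finite (pverts G) \<and> parcs G \<subseteq> pverts G \<times> pverts G \<and>
     (\<forall>u w. (u, w) \<in> parcs G \<longrightarrow> (w, u) \<in> parcs G \<and> u \<noteq> w)"
    using pair_finite_verts in_arcsD1 in_arcsD2 pair_no_loops pair_sym_arcs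
    unfolding symmetric_def sym_def by fastforce
next
  assume *: "finite (pverts G) \<and> parcs G \<subseteq> pverts G \<times> pverts G \<and>
     (\<forall>u w. (u, w) \<in> parcs G \<longrightarrow> (w, u) \<in> parcs G \<and> u \<noteq> w)"
  then have "finite (parcs G)"
    by (meson finite_SigmaI finite_subset)
  with * show "pair_graph G"
    by unfold_locales (auto simp: symmetric_def sym_def)
qed

text \<open>
A graph of diameter at most two is connected; for a strongly regular graph this is the case as soon
as \<open>\<mu> > 0\<close>.
\<close>

lemma connected_if_common_neighbours:
  assumes "pair_graph G" "pverts G \<noteq> {}"
    and common: "\<And>u w. u \<in> pverts G \<Longrightarrow> w \<in> pverts G \<Longrightarrow> u \<noteq> w \<Longrightarrow> (u, w) \<notin> parcs G \<Longrightarrow>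
      neighbourhood G u \<inter> neighbourhood G w \<noteq> {}"
  shows "Digraph_Component.connected (with_proj G)"
proof -
  interpret pair_graph G by fact
  have sym: "(u, w) \<in> parcs G \<Longrightarrow> (w, u) \<in> parcs G" for u w
    using pair_graph_iff assms(1) by blast
  have "u \<rightarrow>\<^sup>*\<^bsub>with_proj G\<^esub> w" if u: "u \<in> pverts G" and w: "w \<in> pverts G" for u w
  proof -
    consider "u = w" | "(u, w) \<in> parcs G" | x where "(u, x) \<in> parcs G" "(x, w) \<in> parcs G"
      using common[OF u w] sym unfolding neighbourhood_def by blast
    then show ?thesis
    proof cases
      case 1
      then show ?thesis using u by simp
    next
      case 2
      then show ?thesis by (simp add: reachable_adjI)
    next
      case 3
      then show ?thesis by (meson reachable_adjI reachable_adj_trans)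
    qed
  qed
  then have "u \<rightarrow>\<^sup>*\<^bsub>with_proj (mk_symmetric (with_proj G))\<^esub> w" if "u \<in> pverts G" "w \<in> pverts G" for u w
    using that reachable_mk_symmetricI by blast
  then show ?thesis
    using assms(2) unfolding connected_def by (intro strongly_connectedI) auto
qed

definition adjacency :: "'v pair_pre_digraph \<Rightarrow> 'v \<Rightarrow> 'v \<Rightarrow> real" where
  "adjacency G u w = of_bool ((u, w) \<in> parcs G)"

lemma sum_adjacency:
  assumes "pair_graph G" "l \<subseteq> pverts G"
  shows "(\<Sum>x\<in>pverts G. adjacency G u x * of_bool (x \<in> l)) = real (card (neighbourhood G u \<inter> l))"
proof -
  have "finite (pverts G)" using assms(1) pair_graph_iff by blast
  then have "(\<Sum>x\<in>pverts G. adjacency G u x * of_bool (x \<in> l)) = (\<Sum>x\<in>neighbourhood G u \<inter> l. 1)"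
    using assms(2) by (intro sum.mono_neutral_cong_right) (auto simp: adjacency_def)
  then show ?thesis by simp
qed

lemma sum_adjacency_square:
  assumes "pair_graph G"
  shows "(\<Sum>x\<in>pverts G. adjacency G u x * adjacency G x w)
    = real (card (neighbourhood G u \<inter> neighbourhood G w))"
proof -
  have "neighbourhood G w \<subseteq> pverts G" using assms pair_graph_iff by fastforce
  moreover have "adjacency G x w = of_bool (x \<in> neighbourhood G w)" for x
    using assms unfolding pair_graph_iff adjacency_def by auto
  ultimately show ?thesis
    using sum_adjacency[OF assms, of "neighbourhood G w" u] by (simp del: neighbourhood_iff)
qed

text \<open>
The diagonal, the adjacent and the non-adjacent entries of \<open>A\<^sup>2\<close> are the three families of numbers in
the definition of strong regularity.  Connectedness comes for free from \<open>\<mu> > 0\<close>.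
\<close>

lemma strongly_regular_iff_adjacency_square:
  assumes "mu > 0" "pverts G \<noteq> {}"
  shows "strongly_regular G v k lam mu \<longleftrightarrow> pair_graph G \<and> card (pverts G) = v \<and>
    (\<forall>u\<in>pverts G. \<forall>w\<in>pverts G. (\<Sum>x\<in>pverts G. adjacency G u x * adjacency G x w)
      = (real k - real mu) * of_bool (u = w) + (real lam - real mu) * adjacency G u w + real mu)"
    (is "_ \<longleftrightarrow> pair_graph G \<and> _ \<and> ?sq")
proof (cases "pair_graph G")
  case False
  then show ?thesis by (simp add: strongly_regular_def)
next
  case True
  have loop: "(u, u) \<notin> parcs G" for u using True pair_graph_iff by blast
  have "?sq \<longleftrightarrow> (\<forall>u\<in>pverts G. \<forall>w\<in>pverts G. card (neighbourhood G u \<inter> neighbourhood G w)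
      = (if u = w then k else if (u, w) \<in> parcs G then lam else mu))"
    unfolding sum_adjacency_square[OF True]
    by (intro ball_cong) (auto simp: adjacency_def loop)
  also have "\<dots> \<longleftrightarrow> (\<forall>u\<in>pverts G. card (neighbourhood G u) = k) \<and>
     (\<forall>u \<in> pverts G. \<forall>w \<in> pverts G. (u, w) \<in> parcs G \<longrightarrow>
        card (neighbourhood G u \<inter> neighbourhood G w) = lam) \<and>
     (\<forall>u \<in> pverts G. \<forall>w \<in> pverts G. u \<noteq> w \<and> (u, w) \<notin> parcs G \<longrightarrow>
        card (neighbourhood G u \<inter> neighbourhood G w) = mu)" (is "_ \<longleftrightarrow> ?reg")
    using loop by auto
  finally have eq: "?sq \<longleftrightarrow> ?reg" .
  have "Digraph_Component.connected (with_proj G)" if ?reg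
  proof (rule connected_if_common_neighbours[OF True assms(2)])
    fix u w assume "u \<in> pverts G" "w \<in> pverts G" "u \<noteq> w" "(u, w) \<notin> parcs G"
    with that have "card (neighbourhood G u \<inter> neighbourhood G w) = mu" by blast
    with assms(1) show "neighbourhood G u \<inter> neighbourhood G w \<noteq> {}" by auto
  qed
  with True eq show ?thesis unfolding strongly_regular_def by blast
qed

text \<open>
The entries \<open>a u w - d u * e w - e u * d w\<close> are those of \<open>Q A Q\<close> for the reflection \<open>Q\<close> in \<open>d\<close>: if
\<open>A d = m e + g d\<close> with \<open>e\<close> orthogonal to \<open>d\<close>, the multiples of \<open>d d\<^sup>T\<close> in the expansion of \<open>Q A Q\<close> cancel.
The proof computes the square directly.  Applying \<open>A\<close> to \<open>A d\<close> and using the quadratic equation for \<open>A\<close>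
shows that \<open>A e\<close> is a combination of \<open>e\<close> and \<open>d\<close>, with coefficients \<open>s - g\<close> and \<open>t\<close>.  Evaluating
\<open>d\<^sup>T A e\<close> in two ways then gives \<open>e \<bullet> e = 2 t\<close>, and this is exactly what makes the terms in \<open>d d\<^sup>T\<close> vanish
from the square.
\<close>

lemma switching_preserves_square:
  fixes a :: "'v \<Rightarrow> 'v \<Rightarrow> real" and d e :: "'v \<Rightarrow> real" and m g r s c :: real
  assumes "m \<noteq> 0"
    and sym: "\<And>u w. a u w = a w u"
    and sq: "\<And>u w. u \<in> V \<Longrightarrow> w \<in> V \<Longrightarrow>
      (\<Sum>x\<in>V. a u x * a x w) = r * of_bool (u = w) + s * a u w + c"
    and fin: "finite V"
    and d0: "(\<Sum>x\<in>V. d x) = 0" and dd: "(\<Sum>x\<in>V. d x * d x) = 2 * m"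
    and de: "\<And>x. x \<in> V \<Longrightarrow> d x * e x = 0"
    and ad: "\<And>u. u \<in> V \<Longrightarrow> (\<Sum>x\<in>V. a u x * d x) = m * e u + g * d u"
    and u: "u \<in> V" and w: "w \<in> V"
  shows "(\<Sum>x\<in>V. (a u x - d u * e x - e u * d x) * (a x w - d x * e w - e x * d w))
    = r * of_bool (u = w) + s * (a u w - d u * e w - e u * d w) + c"
proof -
  define t where "t = (r + s * g - g * g) / m"
  have ae: "(\<Sum>x\<in>V. a u x * e x) = (s - g) * e u + t * d u" if u: "u \<in> V" for u
  proof -
    have "(\<Sum>x\<in>V. a u x * (\<Sum>y\<in>V. a x y * d y)) = (\<Sum>y\<in>V. (\<Sum>x\<in>V. a u x * a x y) * d y)"
      unfolding sum_distrib_left sum_distrib_right by (subst sum.swap) (simp add: mult.assoc)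
    also have "\<dots> = (\<Sum>y\<in>V. r * (of_bool (u = y) * d y) + s * (a u y * d y) + c * d y)"
      by (intro sum.cong refl) (subst sq[OF u], simp_all add: algebra_simps)
    also have "\<dots> = r * d u + s * (m * e u + g * d u)"
    proof -
      have "(\<Sum>y\<in>V. of_bool (u = y) * d y) = (\<Sum>y\<in>V. if y = u then d u else 0)"
        by (intro sum.cong) auto
      also have "\<dots> = d u" using fin u by simp
      finally show ?thesis
        using ad[OF u] d0 by (simp add: sum.distrib flip: sum_distrib_left)
    qed
    finally have 1: "(\<Sum>x\<in>V. a u x * (\<Sum>y\<in>V. a x y * d y)) = r * d u + s * (m * e u + g * d u)" .
    have "(\<Sum>x\<in>V. a u x * (\<Sum>y\<in>V. a x y * d y)) = (\<Sum>x\<in>V. m * (a u x * e x) + g * (a u x * d x))"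
      by (intro sum.cong refl) (subst ad, simp_all add: algebra_simps)
    also have "\<dots> = m * (\<Sum>x\<in>V. a u x * e x) + g * (m * e u + g * d u)"
      using ad[OF u] by (simp add: sum.distrib flip: sum_distrib_left)
    finally have "m * (\<Sum>x\<in>V. a u x * e x) = r * d u + (s - g) * (m * e u + g * d u)"
      using 1 by (simp add: algebra_simps)
    moreover have "m * ((s - g) * e u + t * d u) = r * d u + (s - g) * (m * e u + g * d u)"
      using \<open>m \<noteq> 0\<close> by (simp add: t_def field_simps)
    ultimately have "m * (\<Sum>x\<in>V. a u x * e x) = m * ((s - g) * e u + t * d u)" by simp
    then show ?thesis using \<open>m \<noteq> 0\<close> by simp
  qed
  have ed0: "(\<Sum>x\<in>V. e x * d x) = 0" using de by (intro sum.neutral) (simp add: mult.commute)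
  have ee: "(\<Sum>x\<in>V. e x * e x) = 2 * t"
  proof -
    have "(\<Sum>u\<in>V. d u * (\<Sum>x\<in>V. a u x * e x)) = (\<Sum>u\<in>V. t * (d u * d u))"
    proof (intro sum.cong refl)
      fix u assume u: "u \<in> V"
      have "d u * ((s - g) * e u + t * d u) = (s - g) * (d u * e u) + t * (d u * d u)"
        by (simp add: algebra_simps)
      then show "d u * (\<Sum>x\<in>V. a u x * e x) = t * (d u * d u)"
        unfolding ae[OF u] de[OF u] by simp
    qed
    also have "\<dots> = t * (2 * m)" using dd by (simp flip: sum_distrib_left)
    finally have 1: "(\<Sum>u\<in>V. d u * (\<Sum>x\<in>V. a u x * e x)) = t * (2 * m)" .
    have "(\<Sum>u\<in>V. d u * (\<Sum>x\<in>V. a u x * e x)) = (\<Sum>x\<in>V. (\<Sum>u\<in>V. a x u * d u) * e x)"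
      unfolding sum_distrib_left sum_distrib_right
      by (subst sum.swap) (intro sum.cong refl, simp add: sym[of _ x for x])
    also have "\<dots> = (\<Sum>x\<in>V. m * (e x * e x))"
    proof (intro sum.cong refl)
      fix x assume x: "x \<in> V"
      have "(m * e x + g * d x) * e x = m * (e x * e x) + g * (d x * e x)"
        by (simp add: algebra_simps)
      then show "(\<Sum>u\<in>V. a x u * d u) * e x = m * (e x * e x)" using ad[OF x] de[OF x] by simp
    qed
    also have "\<dots> = m * (\<Sum>x\<in>V. e x * e x)" by (simp flip: sum_distrib_left)
    finally show ?thesis using 1 \<open>m \<noteq> 0\<close> by simp
  qed
  \<comment> \<open>It remains to expand the square by bilinearity.\<close>
  have da: "(\<Sum>x\<in>V. d x * a x w) = m * e w + g * d w"
    using ad[OF w] sym[of _ w] by (simp add: mult.commute)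
  have ea: "(\<Sum>x\<in>V. e x * a x w) = (s - g) * e w + t * d w"
    using ae[OF w] sym[of _ w] by (simp add: mult.commute)
  have "(\<Sum>x\<in>V. (a u x - d u * e x - e u * d x) * (a x w - d x * e w - e x * d w))
    = (\<Sum>x\<in>V. a u x * a x w - e w * (a u x * d x) - d w * (a u x * e x)
        - d u * (e x * a x w) + d u * e w * (e x * d x) + d u * d w * (e x * e x)
        - e u * (d x * a x w) + e u * e w * (d x * d x) + e u * d w * (e x * d x))"
    by (intro sum.cong) (simp_all add: algebra_simps)
  also have "\<dots> = (\<Sum>x\<in>V. a u x * a x w) - e w * (\<Sum>x\<in>V. a u x * d x) - d w * (\<Sum>x\<in>V. a u x * e x)
        - d u * (\<Sum>x\<in>V. e x * a x w) + d u * e w * (\<Sum>x\<in>V. e x * d x) + d u * d w * (\<Sum>x\<in>V. e x * e x)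
        - e u * (\<Sum>x\<in>V. d x * a x w) + e u * e w * (\<Sum>x\<in>V. d x * d x) + e u * d w * (\<Sum>x\<in>V. e x * d x)"
    by (simp add: sum.distrib sum_subtractf sum_distrib_left)
  also have "\<dots> = r * of_bool (u = w) + s * (a u w - d u * e w - e u * d w) + c"
    unfolding sq[OF u w] ad[OF u] ae[OF u] da ea ed0 ee dd by (simp add: algebra_simps)
  finally show ?thesis .
qed

text \<open>
The switch set is defined by excluding the vertices adjacent to all of \<open>l'\<close>.  Under the switching condition a vertex
adjacent to all of \<open>l\<close> but not all of \<open>l'\<close> has no neighbour in \<open>l'\<close> at all, since equal numbers of
neighbours would force all of \<open>l'\<close>.
\<close>

lemma in_switch_set_iff:
  assumes pg: "pair_graph G" and fin: "finite l" "finite l'" and card: "card l = card l'"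
    and ne: "l \<noteq> {}" "l' \<noteq> {}"
    and outer: "w \<in> pverts G \<Longrightarrow> w \<notin> l \<union> l' \<Longrightarrow>
      card (neighbourhood G w \<inter> l) = card (neighbourhood G w \<inter> l') \<or>
      l \<subseteq> neighbourhood G w \<and> neighbourhood G w \<inter> l' = {} \<or>
      l' \<subseteq> neighbourhood G w \<and> neighbourhood G w \<inter> l = {}"
  shows "w \<in> switch_set G l l' \<longleftrightarrow>
    w \<notin> l \<union> l' \<and> l \<subseteq> neighbourhood G w \<and> neighbourhood G w \<inter> l' = {}"
proof
  let ?N = "neighbourhood G w"
  have sym: "\<And>u w. (u, w) \<in> parcs G \<longleftrightarrow> (w, u) \<in> parcs G" and irr: "\<And>u. (u, u) \<notin> parcs G"
    using pg unfolding pair_graph_iff by blast+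
  have in_switch: "w \<in> switch_set G l l' \<longleftrightarrow> l \<subseteq> ?N \<and> \<not> l' \<subseteq> ?N \<and> w \<notin> l'"
    using sym unfolding switch_set_def common_nbrs_def neighbourhood_def by blast
  show "w \<notin> l \<union> l' \<and> l \<subseteq> ?N \<and> ?N \<inter> l' = {}" if "w \<in> switch_set G l l'"
  proof -
    from that have w: "l \<subseteq> ?N" "\<not> l' \<subseteq> ?N" "w \<notin> l'" using in_switch by auto
    have "w \<notin> l \<union> l'" using w irr by auto
    moreover have "w \<in> pverts G" using w(1) ne(1) pg pair_graph_iff by fastforce
    moreover have "card (?N \<inter> l) \<noteq> card (?N \<inter> l')"
    proof
      assume "card (?N \<inter> l) = card (?N \<inter> l')"
      moreover have "?N \<inter> l = l" using w(1) by blast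
      ultimately have "?N \<inter> l' = l'" using card fin by (intro card_subset_eq) auto
      with w(2) show False by blast
    qed
    ultimately show ?thesis using outer w by blast
  qed
  show "w \<in> switch_set G l l'" if "w \<notin> l \<union> l' \<and> l \<subseteq> ?N \<and> ?N \<inter> l' = {}"
    using that ne unfolding in_switch by blast
qed

text \<open>
Wang-Qiu-Hu switching.  With \<open>d\<close> the difference of the indicator functions of \<open>l1\<close>, \<open>l2\<close> and \<open>e\<close> that of
the two switch sets, the hypotheses say \<open>A d = m e + (i - j) d\<close>, and the switched graph has adjacency
function \<open>A - d e\<^sup>T - e d\<^sup>T\<close>.
\<close>

proposition strongly_regular_switched_graph:
  assumes srg: "strongly_regular G v k lam mu" and mu: "mu > 0"
    and sub: "l1 \<subseteq> pverts G" "l2 \<subseteq> pverts G" and disj: "l1 \<inter> l2 = {}"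
    and card: "card l1 = m" "card l2 = m" and m: "m > 0"
    and inner1: "\<And>u. u \<in> l1 \<Longrightarrow> card (neighbourhood G u \<inter> l1) = i \<and> card (neighbourhood G u \<inter> l2) = j"
    and inner2: "\<And>u. u \<in> l2 \<Longrightarrow> card (neighbourhood G u \<inter> l2) = i \<and> card (neighbourhood G u \<inter> l1) = j"
    and outer: "\<And>w. w \<in> pverts G \<Longrightarrow> w \<notin> l1 \<union> l2 \<Longrightarrow>
      card (neighbourhood G w \<inter> l1) = card (neighbourhood G w \<inter> l2) \<or>
      l1 \<subseteq> neighbourhood G w \<and> neighbourhood G w \<inter> l2 = {} \<or>
      l2 \<subseteq> neighbourhood G w \<and> neighbourhood G w \<inter> l1 = {}"
  shows "strongly_regular (switched_graph G l1 l2) v k lam mu"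
proof -
  let ?V = "pverts G" and ?G' = "switched_graph G l1 l2" and ?N = "neighbourhood G"
  have pg: "pair_graph G" using srg by (simp add: strongly_regular_def)
  then have fin: "finite ?V" and arcs: "\<And>u w. (u, w) \<in> parcs G \<Longrightarrow> u \<in> ?V \<and> w \<in> ?V"
    and sym: "\<And>u w. (u, w) \<in> parcs G \<longleftrightarrow> (w, u) \<in> parcs G" and irr: "\<And>u. (u, u) \<notin> parcs G"
    unfolding pair_graph_iff by blast+
  have ne: "l1 \<noteq> {}" "l2 \<noteq> {}" using card m by auto
  have finl: "finite l1" "finite l2" using sub fin finite_subset by blast+
  define A1 where "A1 = switch_set G l1 l2"
  define A2 where "A2 = switch_set G l2 l1"
  have A1_iff: "w \<in> A1 \<longleftrightarrow> w \<notin> l1 \<union> l2 \<and> l1 \<subseteq> ?N w \<and> ?N w \<inter> l2 = {}" for w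
    unfolding A1_def using outer by (intro in_switch_set_iff[OF pg finl _ ne]) (auto simp: card)
  have A2_iff: "w \<in> A2 \<longleftrightarrow> w \<notin> l1 \<union> l2 \<and> l2 \<subseteq> ?N w \<and> ?N w \<inter> l1 = {}" for w
  proof -
    have "card (?N w \<inter> l2) = card (?N w \<inter> l1) \<or>
      l2 \<subseteq> ?N w \<and> ?N w \<inter> l1 = {} \<or> l1 \<subseteq> ?N w \<and> ?N w \<inter> l2 = {}"
      if "w \<in> ?V" "w \<notin> l2 \<union> l1" using outer[of w] that unfolding Un_iff by argo
    from in_switch_set_iff[OF pg finl(2,1) _ ne(2,1) this] show ?thesis
      unfolding A2_def by (simp add: card Un_commute)
  qed
  have A12: "w \<in> A1 \<Longrightarrow> w \<notin> A2" for w
    unfolding A1_iff A2_iff using ne by blast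
  have "w \<in> ?V" if "l \<subseteq> ?N w" "l \<noteq> {}" for w l using that arcs by fastforce
  then have A_sub: "A1 \<subseteq> ?V" "A2 \<subseteq> ?V" using A1_iff A2_iff ne by blast+
  have arc': "(u, w) \<in> parcs ?G' \<longleftrightarrow> u \<in> ?V \<and> w \<in> switched_nbhd G l1 l2 u" for u w
    by (simp add: switched_graph_def)
  have nbhd': "switched_nbhd G l1 l2 u = (if u \<in> l1 then (?N u - A1) \<union> A2
      else if u \<in> l2 then (?N u - A2) \<union> A1 else if u \<in> A1 then (?N u - l1) \<union> l2
      else if u \<in> A2 then (?N u - l2) \<union> l1 else ?N u)" for u
    by (simp add: switched_nbhd_def A1_def A2_def Let_def)
  define d :: "'a \<Rightarrow> real" where "d u = of_bool (u \<in> l1) - of_bool (u \<in> l2)" for u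
  define e :: "'a \<Rightarrow> real" where "e u = of_bool (u \<in> A1) - of_bool (u \<in> A2)" for u
  have A_C: "w \<in> A1 \<Longrightarrow> w \<notin> l1 \<and> w \<notin> l2" "w \<in> A2 \<Longrightarrow> w \<notin> l1 \<and> w \<notin> l2" for w
    unfolding A1_iff A2_iff by auto
  have A_N: "w \<in> A1 \<Longrightarrow> u \<in> l1 \<Longrightarrow> (w, u) \<in> parcs G"
      "w \<in> A1 \<Longrightarrow> u \<in> l2 \<Longrightarrow> (w, u) \<notin> parcs G"
      "w \<in> A2 \<Longrightarrow> u \<in> l2 \<Longrightarrow> (w, u) \<in> parcs G"
      "w \<in> A2 \<Longrightarrow> u \<in> l1 \<Longrightarrow> (w, u) \<notin> parcs G" for u w
    unfolding A1_iff A2_iff by auto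
  have A_N': "w \<in> A1 \<Longrightarrow> u \<in> l1 \<Longrightarrow> (u, w) \<in> parcs G"
      "w \<in> A1 \<Longrightarrow> u \<in> l2 \<Longrightarrow> (u, w) \<notin> parcs G"
      "w \<in> A2 \<Longrightarrow> u \<in> l2 \<Longrightarrow> (u, w) \<in> parcs G"
      "w \<in> A2 \<Longrightarrow> u \<in> l1 \<Longrightarrow> (u, w) \<notin> parcs G" for u w
    by (simp_all add: sym[of u w] A_N)
  have l12: "u \<in> l1 \<Longrightarrow> u \<notin> l2" for u using disj by auto
  \<comment> \<open>The four switched sets are pairwise disjoint, which makes the comparison a finite case distinction.\<close>
  have state: "u \<in> l1 \<and> u \<notin> l2 \<and> u \<notin> A1 \<and> u \<notin> A2 \<or> u \<notin> l1 \<and> u \<in> l2 \<and> u \<notin> A1 \<and> u \<notin> A2 \<or>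
      u \<notin> l1 \<and> u \<notin> l2 \<and> u \<in> A1 \<and> u \<notin> A2 \<or> u \<notin> l1 \<and> u \<notin> l2 \<and> u \<notin> A1 \<and> u \<in> A2 \<or>
      u \<notin> l1 \<and> u \<notin> l2 \<and> u \<notin> A1 \<and> u \<notin> A2" for u
    using A_C[of u] A12[of u] l12[of u] by blast
  \<comment> \<open>The switched graph is the matrix \<open>A - d e\<^sup>T - e d\<^sup>T\<close>.\<close>
  have adj': "adjacency ?G' u w = adjacency G u w - d u * e w - e u * d w"
    if u: "u \<in> ?V" for u w
    using state[of u] state[of w] u unfolding adjacency_def arc' nbhd' d_def e_def
    by (elim disjE conjE) (simp_all add: A_N A_N')
  have a_sym: "adjacency G u w = adjacency G w u" for u w using sym by (auto simp: adjacency_def)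
  have pv: "pverts ?G' = ?V" by (simp add: switched_graph_def)
  have pg': "pair_graph ?G'"
    unfolding pair_graph_iff pv
  proof (intro conjI allI impI)
    show "finite ?V" by fact
    have "switched_nbhd G l1 l2 u \<subseteq> ?V" for u
    proof -
      have "?N u \<subseteq> ?V" using arcs by auto
      with A_sub sub show ?thesis unfolding nbhd' by auto
    qed
    then show in_V: "parcs ?G' \<subseteq> ?V \<times> ?V" by (auto simp: arc' subset_eq)
    fix u w assume uw: "(u, w) \<in> parcs ?G'"
    then have V: "u \<in> ?V" "w \<in> ?V" using in_V by auto
    have "adjacency ?G' w u = adjacency ?G' u w"
      unfolding adj'[OF V(1)] adj'[OF V(2)] using a_sym[of u w] by (simp add: algebra_simps)
    with uw show "(w, u) \<in> parcs ?G'" by (auto simp: adjacency_def split: if_splits)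
    have "adjacency ?G' u u = 0"
      unfolding adj'[OF V(1)] using A_C irr by (auto simp: adjacency_def d_def e_def)
    with uw show "u \<noteq> w" by (auto simp: adjacency_def)
  qed
  have ne_V: "?V \<noteq> {}" using ne sub by auto
  have sum_l: "(\<Sum>x\<in>?V. of_bool (x \<in> l)) = real (card l)" if "l \<subseteq> ?V" for l
  proof -
    have "?V \<inter> l = l" using that by auto
    then show ?thesis using fin by (simp add: sum_of_bool_eq)
  qed
  have srg_eq: "card ?V = v \<and> (\<forall>u\<in>?V. \<forall>w\<in>?V. (\<Sum>x\<in>?V. adjacency G u x * adjacency G x w)
      = (real k - real mu) * of_bool (u = w) + (real lam - real mu) * adjacency G u w + real mu)"
    using srg strongly_regular_iff_adjacency_square[OF mu ne_V] by blast
  have "(\<Sum>x\<in>?V. adjacency ?G' u x * adjacency ?G' x w)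
      = (real k - real mu) * of_bool (u = w) + (real lam - real mu) * adjacency ?G' u w + real mu"
    if u: "u \<in> ?V" and w: "w \<in> ?V" for u w
  proof -
    have "(\<Sum>x\<in>?V. adjacency ?G' u x * adjacency ?G' x w)
      = (\<Sum>x\<in>?V. (adjacency G u x - d u * e x - e u * d x) * (adjacency G x w - d x * e w - e x * d w))"
      using u by (intro sum.cong) (simp_all add: adj')
    also have "\<dots> = (real k - real mu) * of_bool (u = w)
        + (real lam - real mu) * (adjacency G u w - d u * e w - e u * d w) + real mu"
    proof (rule switching_preserves_square[where m = "real m" and g = "real i - real j"])
      show "real m \<noteq> 0" "finite ?V" "u \<in> ?V" "w \<in> ?V" using m fin u w by auto
      show "adjacency G u w = adjacency G w u" for u w by (fact a_sym)
      show "(\<Sum>x\<in>?V. adjacency G u x * adjacency G x w) = (real k - real mu) * of_bool (u = w)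
        + (real lam - real mu) * adjacency G u w + real mu" if "u \<in> ?V" "w \<in> ?V" for u w
        using srg_eq that by blast
      show "(\<Sum>x\<in>?V. d x) = 0"
        unfolding d_def sum_subtractf sum_l[OF sub(1)] sum_l[OF sub(2)] using card by simp
      have "(\<Sum>x\<in>?V. d x * d x) = (\<Sum>x\<in>?V. of_bool (x \<in> l1) + of_bool (x \<in> l2))"
        using disj by (intro sum.cong) (auto simp: d_def)
      then show "(\<Sum>x\<in>?V. d x * d x) = 2 * real m"
        unfolding sum.distrib sum_l[OF sub(1)] sum_l[OF sub(2)] using card by simp
      show "d x * e x = 0" for x using A_C by (auto simp: d_def e_def)
      \<comment> \<open>The regularity hypotheses are precisely the equation \<open>A d = m e + (i - j) d\<close>.\<close>
      show "(\<Sum>x\<in>?V. adjacency G u x * d x) = real m * e u + (real i - real j) * d u"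
        if u: "u \<in> ?V" for u
      proof -
        have "(\<Sum>x\<in>?V. adjacency G u x * d x) = real (card (?N u \<inter> l1)) - real (card (?N u \<inter> l2))"
          unfolding d_def right_diff_distrib sum_subtractf
            sum_adjacency[OF pg sub(1)] sum_adjacency[OF pg sub(2)] by (rule refl)
        also have "\<dots> = real m * e u + (real i - real j) * d u"
        proof (cases "u \<in> l1 \<union> l2")
          case True
          then show ?thesis using inner1[of u] inner2[of u] A_C[of u] l12[of u]
            by (auto simp: d_def e_def)
        next
          case False
          then have d: "d u = 0" by (simp add: d_def)
          consider "card (?N u \<inter> l1) = card (?N u \<inter> l2)" "u \<notin> A1" "u \<notin> A2" | "u \<in> A1" | "u \<in> A2"
            using outer[OF u False] A1_iff[of u] A2_iff[of u] False by blast
          then show ?thesis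
          proof cases
            case 1
            then show ?thesis using d by (simp add: e_def)
          next
            case 2
            then have "?N u \<inter> l1 = l1" "?N u \<inter> l2 = {}" using A1_iff[of u] by auto
            then show ?thesis using d 2 A12[of u] card by (simp add: e_def)
          next
            case 3
            then have "?N u \<inter> l2 = l2" "?N u \<inter> l1 = {}" using A2_iff[of u] by auto
            then show ?thesis using d 3 A12[of u] card by (auto simp: e_def)
          qed
        qed
        finally show ?thesis .
      qed
    qed
    finally show ?thesis using u by (simp add: adj')
  qed
  then show ?thesis
    using strongly_regular_iff_adjacency_square[of mu ?G' v k lam] mu ne_V pg' srg_eq by (simp add: pv)
qed

section \<open>Counting fibres and points over a finite field\<close>

lemma card_eq_sum_fibres:
  assumes "finite A" "finite C" "f ` A \<subseteq> C"
  shows "card A = (\<Sum>c\<in>C. card {a \<in> A. f a = c})"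
proof -
  have "(\<Sum>a\<in>A. 1::nat) = (\<Sum>c\<in>C. \<Sum>a\<in>{a \<in> A. f a = c}. 1)"
    using sum.group[OF assms, of "\<lambda>_. 1::nat"] by simp
  then show ?thesis by simp
qed

lemma card_Collect_bij_betw:
  assumes "bij_betw f D W"
  shows "card {z \<in> W. P z} = card {d \<in> D. P (f d)}"
proof -
  have "bij_betw f {d \<in> D. P (f d)} {z \<in> W. P z}"
    using assms by (auto simp: bij_betw_def inj_on_def)
  then show ?thesis by (simp add: bij_betw_same_card)
qed

text \<open>
A counting device for norm and trace of a finite field: the degree of a polynomial bounds the fibres
and the image from above, and the cardinality of the domain leaves no slack, so all bounds are
attained.
\<close>

lemma fibres_exact_if_bounded:
  assumes fin: "finite A" "finite C" and img: "f ` A \<subseteq> C" and card: "card A = m * k"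
    and C: "card C \<le> m" and fibre: "\<And>c. c \<in> C \<Longrightarrow> card {a \<in> A. f a = c} \<le> k" and k: "k > 0"
  shows "card C = m" and "\<And>c. c \<in> C \<Longrightarrow> card {a \<in> A. f a = c} = k"
proof -
  have sum: "m * k = (\<Sum>c\<in>C. card {a \<in> A. f a = c})"
    using card_eq_sum_fibres[OF fin img] card by simp
  also have "\<dots> \<le> (\<Sum>c\<in>C. k)" by (intro sum_mono fibre)
  also have "\<dots> = card C * k" by simp
  finally have "m \<le> card C" using k by simp
  then show "card C = m" using C by simp
  show "card {a \<in> A. f a = c} = k" if c: "c \<in> C" for c
  proof (rule ccontr)
    assume "card {a \<in> A. f a = c} \<noteq> k"
    then have "card {a \<in> A. f a = c} < k" using fibre[OF c] by simp
    then have "(\<Sum>c\<in>C. card {a \<in> A. f a = c}) < (\<Sum>c\<in>C. k)"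
      using c fibre fin by (intro sum_strict_mono_ex1) auto
    then show False using sum \<open>card C = m\<close> by simp
  qed
qed

lemma card_monic_roots_le:
  fixes s :: "'a::field poly"
  assumes "degree s < r"
  shows "card {x. x ^ r + poly s x = 0} \<le> r"
proof -
  have deg: "degree (monom 1 r + s) = r"
    using assms by (subst degree_add_eq_left) (auto simp: degree_monom_eq)
  then have "monom 1 r + s \<noteq> 0" using assms by auto
  from card_poly_roots_bound[OF this] show ?thesis by (simp add: deg poly_monom)
qed

text \<open>
The additive group is annihilated by its order, so the characteristic divides \<open>q\<^sup>r\<close> and \<open>q\<close> is
a power of it.
\<close>

lemma finite_field_frobenius:
  fixes x y :: "'a::{field,finite}"
  assumes "primepow q" and "CARD('a) = q ^ r"
  shows "(x + y) ^ q = x ^ q + y ^ q"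
proof -
  obtain p k where p: "prime p" and q: "q = p ^ k"
    using assms(1) by (auto simp: primepow_def)
  have "(\<Sum>z\<in>UNIV. z) = (\<Sum>z\<in>UNIV. z + (1::'a))"
    by (rule sum.reindex_bij_witness[of _ "\<lambda>z. z + 1" "\<lambda>z. z - 1"]) auto
  then have "of_nat CARD('a) = (0::'a)" by (simp add: sum.distrib)
  then have "CHAR('a) dvd p ^ (k * r)"
    by (simp only: of_nat_eq_0_iff_char_dvd assms(2) q power_mult)
  moreover have char: "prime CHAR('a)"
    by (rule prime_CHAR_semidom[OF finite_imp_CHAR_pos]) simp
  ultimately have "CHAR('a) = p" using p by (meson prime_dvd_power primes_dvd_imp_eq)
  with char show ?thesis using freshmans_dream'[of q k x y] q by simp
qed

lemma in_span_singleton: "z \<in> vec.span {x} \<longleftrightarrow> (\<exists>c. z = c *s x)"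
  for x z :: "'a::field ^ 'n"
  by (auto simp: vec.span_singleton)

lemma in_span_pair: "z \<in> vec.span {x, y} \<longleftrightarrow> (\<exists>a b. z = a *s x + b *s y)"
  for x y z :: "'a::field ^ 'n"
proof -
  have "z - a *s x = b *s y \<longleftrightarrow> z = a *s x + b *s y" for a b by (auto simp: algebra_simps)
  then show ?thesis unfolding vec.span_breakdown_eq[of z x] in_span_singleton by simp
qed

lemma span_singleton_eq_iff:
  fixes x y :: "'a::field ^ 'n"
  assumes "x \<noteq> 0"
  shows "vec.span {x} = vec.span {y} \<longleftrightarrow> (\<exists>c. c \<noteq> 0 \<and> y = c *s x)"
proof
  assume eq: "vec.span {x} = vec.span {y}"
  then have "y \<in> vec.span {x}" "x \<in> vec.span {y}"
    using vec.span_base[of x "{x}"] vec.span_base[of y "{y}"] by auto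
  then obtain c where c: "y = c *s x" using in_span_singleton by blast
  obtain d where d: "x = d *s y" using \<open>x \<in> vec.span {y}\<close> in_span_singleton by blast
  have "c \<noteq> 0"
  proof
    assume "c = 0"
    then have "y = 0" using c by simp
    then show False using d assms by simp
  qed
  with c show "\<exists>c. c \<noteq> 0 \<and> y = c *s x" by blast
next
  assume "\<exists>c. c \<noteq> 0 \<and> y = c *s x"
  then obtain c where c: "c \<noteq> 0" "y = c *s x" by blast
  then have "x = (1 / c) *s y" by simp
  then have "x \<in> vec.span {y}" "y \<in> vec.span {x}"
    using c(2) unfolding in_span_singleton by blast+
  then show "vec.span {x} = vec.span {y}"
    by (intro antisym vec.span_minimal) simp_all
qed

text \<open>
Points are handled through spanning vectors from here on.
\<close>

lemma proj_point_iff: "proj_point X \<longleftrightarrow> (\<exists>x. x \<noteq> 0 \<and> X = vec.span {x})"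
proof
  assume "proj_point X"
  then have X: "vec.subspace X" "vec.dim X = 1" by (auto simp: proj_point_def)
  obtain b where b: "b \<subseteq> X" "vec.independent b" "X \<subseteq> vec.span b" "card b = vec.dim X"
    using vec.basis_exists by blast
  then obtain x where "b = {x}" using X by (metis card_1_singletonE)
  with b X have "X = vec.span {x}" "x \<noteq> 0"
    using vec.span_minimal[of b X] vec.dependent_zero[of b] by auto
  then show "\<exists>x. x \<noteq> 0 \<and> X = vec.span {x}" by blast
qed (auto simp: proj_point_def)

lemma points_of_iff:
  assumes "vec.subspace U"
  shows "X \<in> points_of U \<longleftrightarrow> (\<exists>x. x \<noteq> 0 \<and> x \<in> U \<and> X = vec.span {x})"
proof -
  have "vec.span {x} \<subseteq> U \<longleftrightarrow> x \<in> U" for x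
    using assms vec.span_minimal[of "{x}" U] vec.span_base[of x "{x}"] by auto
  then show ?thesis unfolding points_of_def proj_point_iff by auto
qed

lemma proj_join_points: "proj_join (vec.span {x}) (vec.span {y}) = vec.span {x, y}"
  by (simp only: vec.span_Un vec.span_span insert_is_Un[of x "{y}"] proj_join_def)

section \<open>The Hermitian form and the quadratic field extension\<close>

locale hermitian_space =
  fixes q :: nat and B :: "'a::{field,finite} ^ 'n \<Rightarrow> 'a ^ 'n \<Rightarrow> 'a"
  assumes primepow_q: "primepow q" and card_field: "CARD('a) = q ^ 2"
    and form: "nondegenerate_hermitian_form q B"
begin

lemma q_ge_2: "q \<ge> 2"
  using primepow_q primepow_gt_Suc_0 by fastforce

lemma q_pos [simp]: "q > 0"
  using q_ge_2 by simp

lemma q_nonzero [simp]: "q \<noteq> 0"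
  using q_ge_2 by simp

definition conjugate :: "'a \<Rightarrow> 'a" where "conjugate x = x ^ q"

lemma B_sym: "B y x = conjugate (B x y)"
  using form unfolding nondegenerate_hermitian_form_def conjugate_def by blast

lemma B_linear: "Vector_Spaces.linear (*s) (*) (\<lambda>x. B x y)"
  using form unfolding nondegenerate_hermitian_form_def by blast

lemma B_left [simp]: "B (x + x') y = B x y + B x' y" "B (c *s x) y = c * B x y" "B 0 y = 0"
  "B (- x) y = - B x y" "B (x - x') y = B x y - B x' y"
proof -
  interpret Vector_Spaces.linear "(*s)" "(*)" "\<lambda>x. B x y" by (fact B_linear)
  show "B (x + x') y = B x y + B x' y" "B (c *s x) y = c * B x y" "B 0 y = 0"
    "B (- x) y = - B x y" "B (x - x') y = B x y - B x' y"
    by (fact add scale zero neg diff)+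
qed

text \<open>
The Hermitian symmetry, applied twice, says that values of \<open>B\<close> are fixed by the square of the
conjugation; and every field element is a value of \<open>B\<close>.
\<close>

lemma conjugate_involution: "conjugate (conjugate x) = x"
proof -
  have "\<forall>y. (\<forall>z. B y z = 0) \<longrightarrow> y = 0"
    using form unfolding nondegenerate_hermitian_form_def by (elim conjE)
  moreover have "(1 :: 'a ^ 'n) \<noteq> 0" by (rule one_neq_zero)
  ultimately obtain y z where yz: "B y z \<noteq> 0" by blast
  define u where "u = (x / B y z) *s y"
  have "B u z = x" using yz by (simp add: u_def)
  moreover have "conjugate (conjugate (B u z)) = B u z" by (simp only: B_sym[of z u, symmetric] B_sym[of u z, symmetric])
  ultimately show ?thesis by simp
qed

definition fnorm :: "'a \<Rightarrow> 'a" where "fnorm x = x * conjugate x"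

definition fixed_field :: "'a set" where "fixed_field = {x. conjugate x = x}"

lemma conjugate_simps [simp]:
  "conjugate 0 = 0" "conjugate 1 = 1" "conjugate (x * y) = conjugate x * conjugate y" "conjugate (x / y) = conjugate x / conjugate y"
  "conjugate (x + y) = conjugate x + conjugate y" "conjugate (conjugate x) = x" "conjugate x = 0 \<longleftrightarrow> x = 0"
proof -
  show "conjugate (x + y) = conjugate x + conjugate y"
    unfolding conjugate_def by (rule finite_field_frobenius[OF primepow_q card_field])
  show "conjugate (conjugate x) = x" by (rule conjugate_involution)
qed (simp_all add: conjugate_def power_mult_distrib power_divide)

lemma conjugate_uminus [simp]: "conjugate (- x) = - conjugate x"
  using conjugate_simps(5)[of x "- x"] by (simp add: eq_neg_iff_add_eq_0 add.commute)

lemma conjugate_diff [simp]: "conjugate (x - y) = conjugate x - conjugate y"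
  using conjugate_simps(5)[of x "- y"] by simp

lemma fnorm_simps [simp]: "fnorm 0 = 0" "fnorm 1 = 1" "fnorm (x * y) = fnorm x * fnorm y" "fnorm (x / y) = fnorm x / fnorm y"
  "fnorm (conjugate x) = fnorm x" "fnorm x = 0 \<longleftrightarrow> x = 0" "fnorm (- x) = fnorm x" "conjugate (fnorm x) = fnorm x"
  by (auto simp: fnorm_def)

lemma fixed_field_iff: "x \<in> fixed_field \<longleftrightarrow> conjugate x = x"
  by (simp add: fixed_field_def)

lemma card_fixed_field_le: "card fixed_field \<le> q"
proof -
  have "card {x. x ^ q + poly [:0, -1:] x = (0::'a)} \<le> q"
    using q_ge_2 by (intro card_monic_roots_le) auto
  then show ?thesis by (simp add: fixed_field_def conjugate_def)
qed

lemma card_trace_fibre: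
  assumes "c \<in> fixed_field"
  shows "card {a. a + conjugate a = c} = q"
proof -
  have "card {a \<in> UNIV. a + conjugate a = c} = q"
  proof (rule fibres_exact_if_bounded(2)[OF _ _ _ _ card_fixed_field_le _ _ assms])
    show "(\<lambda>a. a + conjugate a) ` UNIV \<subseteq> fixed_field" by (auto simp: fixed_field_iff add.commute)
    show "CARD('a) = q * q" by (simp add: card_field power2_eq_square)
    show "card {a \<in> UNIV. a + conjugate a = c} \<le> q" for c
    proof -
      have "card {x. x ^ q + poly [:-c, 1:] x = (0::'a)} \<le> q"
        using q_ge_2 by (intro card_monic_roots_le) auto
      also have "{x. x ^ q + poly [:-c, 1:] x = (0::'a)} = {a \<in> UNIV. a + conjugate a = c}"
        by (auto simp: conjugate_def algebra_simps)
      finally show ?thesis .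
    qed
  qed auto
  then show ?thesis by simp
qed

lemma trace_surj:
  assumes "c \<in> fixed_field"
  obtains a where "a + conjugate a = c"
proof -
  have "{a. a + conjugate a = c} \<noteq> {}" using card_trace_fibre[OF assms] q_pos by (metis card.empty less_numeral_extra(3))
  then show thesis using that by blast
qed

text \<open>
The norm maps the \<open>(q - 1) * (q + 1)\<close> non-zero elements to the at most \<open>q - 1\<close> non-zero elements of the
fixed field, with fibres of size at most \<open>q + 1\<close>; hence both bounds are attained.
\<close>

lemma card_fixed_field_and_norm_fibre:
  shows card_fixed_field: "card fixed_field = q"
    and card_norm_fibre: "c \<in> fixed_field \<Longrightarrow> c \<noteq> 0 \<Longrightarrow> card {a. fnorm a = c} = q + 1"
proof -
  have K0: "0 \<in> fixed_field" by (simp add: fixed_field_iff)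
  have img: "fnorm ` (UNIV - {0}) \<subseteq> fixed_field - {0}" by (auto simp: fixed_field_iff)
  have "q * q - 1 = (q - 1) * (q + 1)" by (simp add: algebra_simps)
  then have card: "card (UNIV - {0::'a}) = (q - 1) * (q + 1)"
    using card_field by (simp add: power2_eq_square card_Diff_singleton)
  have le: "card (fixed_field - {0}) \<le> q - 1" using card_fixed_field_le K0 by (simp add: card_Diff_singleton)
  have fib: "card {a \<in> UNIV - {0}. fnorm a = c} \<le> q + 1" for c
  proof -
    have "card {x. x ^ (q + 1) + poly [:-c:] x = (0::'a)} \<le> q + 1"
      by (intro card_monic_roots_le) auto
    moreover have "card {a \<in> UNIV - {0}. fnorm a = c} \<le> card {x. x ^ (q + 1) + poly [:-c:] x = (0::'a)}"
      by (intro card_mono) (auto simp: fnorm_def conjugate_def)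
    ultimately show ?thesis by simp
  qed
  have "card (fixed_field - {0}) = q - 1"
    by (rule fibres_exact_if_bounded(1)[OF _ _ img card le]) (use fib in auto)
  moreover have "card (fixed_field - {0}) = card fixed_field - 1" using K0 by (simp add: card_Diff_singleton)
  moreover have "card fixed_field > 0" using K0 by (auto simp: card_gt_0_iff)
  ultimately show "card fixed_field = q" using q_ge_2 by simp
  show "card {a. fnorm a = c} = q + 1" if "c \<in> fixed_field" "c \<noteq> 0"
  proof -
    have "card {a \<in> UNIV - {0}. fnorm a = c} = q + 1"
      by (rule fibres_exact_if_bounded(2)[OF _ _ img card le]) (use fib that in auto)
    moreover have "{a \<in> UNIV - {0}. fnorm a = c} = {a. fnorm a = c}" using that by auto
    ultimately show ?thesis by simp
  qed
qed

lemma norm_surj: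
  assumes "c \<in> fixed_field"
  obtains a where "fnorm a = c"
proof (cases "c = 0")
  case False
  then have "{a. fnorm a = c} \<noteq> {}"
    using card_norm_fibre[OF assms] by (metis add_is_0 card.empty one_neq_zero)
  then show thesis using that by blast
qed (use that[of 0] in simp)

lemma B_right [simp]: "B y (x + x') = B y x + B y x'" "B y (c *s x) = conjugate c * B y x" "B y 0 = 0"
  "B y (- x) = - B y x" "B y (x - x') = B y x - B y x'"
  by (simp_all add: B_sym[of y])

lemma B_self_in_fixed_field: "B x x \<in> fixed_field"
  unfolding fixed_field_iff by (rule B_sym[symmetric])

lemma B_eq_0_sym: "B x y = 0 \<longleftrightarrow> B y x = 0"
  using B_sym[of x y] by simp

section \<open>Vectors of given norm in a non-degenerate subspace\<close>

definition nondegenerate :: "('a ^ 'n) set \<Rightarrow> bool" where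
  "nondegenerate W \<longleftrightarrow> vec.subspace W \<and> (\<forall>x\<in>W. (\<forall>y\<in>W. B x y = 0) \<longrightarrow> x = 0)"

definition perp :: "('a ^ 'n) set \<Rightarrow> 'a ^ 'n \<Rightarrow> ('a ^ 'n) set" where
  "perp W x = {w \<in> W. B w x = 0}"

lemma card_Collect_translate:
  fixes x :: "'a ^ 'n"
  assumes "vec.subspace W" "x \<in> W" "\<And>u. u \<in> W \<Longrightarrow> P (u + x) \<longleftrightarrow> Q u"
  shows "card {u \<in> W. P u} = card {u \<in> W. Q u}"
proof -
  have "bij_betw (\<lambda>u. u + x) W W"
    using assms by (intro bij_betw_byWitness[where f' = "\<lambda>u. u - x"])
      (auto intro: vec.subspace_add vec.subspace_diff)
  then have "card {u \<in> W. P u} = card {u \<in> W. P (u + x)}" by (rule card_Collect_bij_betw)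
  also have "{u \<in> W. P (u + x)} = {u \<in> W. Q u}" using assms(3) by blast
  finally show ?thesis .
qed

lemma nondegenerate_UNIV: "nondegenerate UNIV"
proof -
  have "\<forall>x. (\<forall>y. B x y = 0) \<longrightarrow> x = 0"
    using form unfolding nondegenerate_hermitian_form_def by (elim conjE)
  then show ?thesis by (simp add: nondegenerate_def)
qed

text \<open>
Polarization: if \<open>x\<close> and \<open>y\<close> are isotropic and \<open>B x y \<noteq> 0\<close>, a multiple of \<open>x\<close> can be chosen such that
the cross terms of \<open>B (c *s x + y) (c *s x + y)\<close> add up to \<open>1\<close>, an element
of trace \<open>1\<close> being available.
\<close>

lemma exists_nonisotropic:
  assumes "nondegenerate W" "W \<noteq> {0}"
  obtains x where "x \<in> W" "B x x \<noteq> 0"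
proof -
  have sub: "vec.subspace W" using assms by (simp add: nondegenerate_def)
  obtain x where x: "x \<in> W" "x \<noteq> 0"
    using assms vec.subspace_0[OF sub] by auto
  then obtain y where y: "y \<in> W" "B x y \<noteq> 0" using assms(1) by (auto simp: nondegenerate_def)
  obtain a where a: "a + conjugate a = 1" using trace_surj[of 1] by (auto simp: fixed_field_iff)
  define c where "c = a / B x y"
  let ?z = "c *s x + y"
  have "?z \<in> W" using sub x y by (simp add: vec.subspace_add vec.subspace_scale)
  moreover have "B ?z ?z = fnorm c * B x x + B y y + (c * B x y + conjugate (c * B x y))"
    by (simp add: fnorm_def B_sym[of y x] algebra_simps)
  then have "B ?z ?z = fnorm c * B x x + B y y + 1" using y a by (simp add: c_def)
  then have "B x x \<noteq> 0 \<or> B y y \<noteq> 0 \<or> B ?z ?z \<noteq> 0" by auto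
  ultimately show thesis using that x y by blast
qed

lemma subspace_perp: "vec.subspace W \<Longrightarrow> vec.subspace (perp W x)"
  by (auto simp: perp_def vec.subspace_def)

lemma perp_decomposition:
  assumes W: "vec.subspace W" and x: "x \<in> W" "B x x \<noteq> 0"
  shows "bij_betw (\<lambda>(a, w). a *s x + w) (UNIV \<times> perp W x) W"
proof (rule bij_betw_byWitness[where f' = "\<lambda>z. (B z x / B x x, z - (B z x / B x x) *s x)"])
  show "\<forall>aw\<in>UNIV \<times> perp W x. (B (case aw of (a, w) \<Rightarrow> a *s x + w) x / B x x,
     (case aw of (a, w) \<Rightarrow> a *s x + w) - (B (case aw of (a, w) \<Rightarrow> a *s x + w) x / B x x) *s x) = aw"
    using x by (auto simp: perp_def)
  show "\<forall>z\<in>W. (case (B z x / B x x, z - (B z x / B x x) *s x) of (a, w) \<Rightarrow> a *s x + w) = z" by simp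
  show "(\<lambda>(a, w). a *s x + w) ` (UNIV \<times> perp W x) \<subseteq> W"
    using W x by (auto simp: perp_def vec.subspace_add vec.subspace_scale)
  show "(\<lambda>z. (B z x / B x x, z - (B z x / B x x) *s x)) ` W \<subseteq> UNIV \<times> perp W x"
    using W x by (auto simp: perp_def vec.subspace_diff vec.subspace_scale)
qed

lemma card_perp_decomposition:
  assumes W: "vec.subspace W" and x: "x \<in> W" "B x x \<noteq> 0"
  shows "card {z \<in> W. P z} = (\<Sum>a\<in>UNIV. card {w \<in> perp W x. P (a *s x + w)})"
proof -
  define f where "f = (\<lambda>(a, w). a *s x + w)"
  let ?D = "UNIV \<times> perp W x"
  have bij: "bij_betw f ?D W" unfolding f_def by (rule perp_decomposition[OF assms])
  have "card {z \<in> W. P z} = card {d \<in> ?D. P (f d)}" by (rule card_Collect_bij_betw[OF bij])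
  also have "{d \<in> ?D. P (f d)} = (SIGMA a:UNIV. {w \<in> perp W x. P (a *s x + w)})"
    by (intro set_eqI) (force simp: f_def mem_Times_iff)
  also have "card \<dots> = (\<Sum>a\<in>UNIV. card {w \<in> perp W x. P (a *s x + w)})"
    by (rule card_SigmaI) simp_all
  finally show ?thesis .
qed

lemma nondegenerate_perp:
  assumes W: "nondegenerate W" and x: "x \<in> W" "B x x \<noteq> 0"
  shows "nondegenerate (perp W x)" and "vec.dim W = Suc (vec.dim (perp W x))"
proof -
  have sub: "vec.subspace W" using W by (simp add: nondegenerate_def)
  have split: "\<exists>a w. w \<in> perp W x \<and> z = a *s x + w" if "z \<in> W" for z
  proof -
    have "z - (B z x / B x x) *s x \<in> perp W x"
      using that sub x by (simp add: perp_def vec.subspace_diff vec.subspace_scale)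
    moreover have "z = (B z x / B x x) *s x + (z - (B z x / B x x) *s x)" by simp
    ultimately show ?thesis by metis
  qed
  show "nondegenerate (perp W x)"
    unfolding nondegenerate_def
  proof (intro conjI ballI impI)
    show "vec.subspace (perp W x)" using sub by (rule subspace_perp)
    fix u assume u: "u \<in> perp W x" and orth: "\<forall>y\<in>perp W x. B u y = 0"
    have "B u z = 0" if "z \<in> W" for z
      using split[OF that] u orth by (auto simp: perp_def)
    moreover have "u \<in> W" using u by (simp add: perp_def)
    ultimately show "u = 0" using W by (simp add: nondegenerate_def)
  qed
  have "vec.span (insert x (perp W x)) = W"
  proof
    show "vec.span (insert x (perp W x)) \<subseteq> W"
      using sub x by (intro vec.span_minimal) (auto simp: perp_def)
    show "W \<subseteq> vec.span (insert x (perp W x))"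
    proof
      fix z assume "z \<in> W"
      then obtain a w where "w \<in> perp W x" "z = a *s x + w" using split by blast
      then show "z \<in> vec.span (insert x (perp W x))"
        by (simp add: vec.span_add vec.span_base vec.span_scale)
    qed
  qed
  then have "vec.dim W = vec.dim (insert x (perp W x))" by (metis vec.dim_span)
  moreover have "x \<notin> vec.span (perp W x)"
    using x subspace_perp[OF sub] by (simp add: perp_def vec.span_eq_iff[THEN iffD2])
  ultimately show "vec.dim W = Suc (vec.dim (perp W x))" by (simp add: vec.dim_insert)
qed

text \<open>
The number of isotropic vectors, zero included, of a non-degenerate space of dimension \<open>m\<close>.  The
quotient has the value \<open>1\<close> for \<open>m = 0\<close>, which is where the induction starts.
\<close>

definition num_isotropic :: "nat \<Rightarrow> real" where
  "num_isotropic m = (real q ^ (2 * m) + (-1) ^ m * (real q - 1) * real q ^ m) / real q"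

text \<open>
The number of vectors of any fixed non-zero norm (in the fixed field) in a non-degenerate space of
dimension \<open>m\<close>.
\<close>

definition num_norm :: "nat \<Rightarrow> real" where
  "num_norm m = (real q ^ (2 * m) - (-1) ^ m * real q ^ m) / real q"

lemma num_recurrences:
  "num_isotropic (Suc m) = num_isotropic m - num_norm m + real q ^ 2 * num_norm m"
  "num_norm (Suc m) = (real q + 1) * (num_isotropic m - num_norm m) + real q ^ 2 * num_norm m"
  unfolding num_isotropic_def num_norm_def by (simp_all add: field_simps power2_eq_square)

text \<open>
Split \<open>W\<close> as the orthogonal sum of \<open>\<langle>x\<rangle>\<close> with \<open>B x x \<noteq> 0\<close> and its complement.  A vector \<open>a *s x + w\<close> has
norm \<open>c\<close> iff \<open>w\<close> has norm \<open>c - fnorm a * B x x\<close>, which vanishes for one \<open>a\<close> if \<open>c = 0\<close>, and for \<open>q + 1\<close>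
values of \<open>a\<close> for any other \<open>c\<close> in the fixed field.
\<close>

lemma card_by_norm:
  assumes "nondegenerate W" "vec.dim W = m"
  shows "real (card {z \<in> W. B z z = c}) = (if c = 0 then num_isotropic m else if c \<in> fixed_field then num_norm m else 0)"
  using assms
proof (induction m arbitrary: W c)
  case 0
  then have "W = {0}" using vec.subspace_0 by (auto simp: nondegenerate_def vec.dim_eq_0)
  then have "{z \<in> W. B z z = c} = (if c = 0 then {0} else {})" by auto
  then show ?case by (simp add: num_isotropic_def num_norm_def)
next
  case (Suc m)
  have sub: "vec.subspace W" using Suc.prems by (simp add: nondegenerate_def)
  have "W \<noteq> {0}" using Suc.prems by auto
  then obtain x where x: "x \<in> W" "B x x \<noteq> 0" using exists_nonisotropic Suc.prems by blast
  have W': "nondegenerate (perp W x)" "vec.dim (perp W x) = m"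
    using nondegenerate_perp[OF Suc.prems(1) x] Suc.prems(2) by auto
  show ?case
  proof (cases "c \<in> fixed_field")
    case False
    then have "{z \<in> W. B z z = c} = {}" using B_self_in_fixed_field by auto
    then show ?thesis using False by (auto simp: fixed_field_iff)
  next
    case c: True
    define S where "S = {a. fnorm a = c / B x x}"
    have Bxx: "B x x \<in> fixed_field" by (rule B_self_in_fixed_field)
    have S: "real (card S) = (if c = 0 then 1 else real q + 1)"
    proof (cases "c = 0")
      case True
      then have "S = {0}" by (auto simp: S_def)
      then show ?thesis using True by simp
    next
      case False
      then show ?thesis
        unfolding S_def using card_norm_fibre[of "c / B x x"] x c Bxx by (simp add: fixed_field_iff)
    qed
    have "real (card {z \<in> W. B z z = c})
        = (\<Sum>a\<in>UNIV. real (card {w \<in> perp W x. B (a *s x + w) (a *s x + w) = c}))"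
      by (subst card_perp_decomposition[OF sub x]) simp
    also have "\<dots> = (\<Sum>a\<in>UNIV. (num_isotropic m - num_norm m) * of_bool (a \<in> S) + num_norm m)"
    proof (intro sum.cong refl)
      fix a :: 'a
      have "{w \<in> perp W x. B (a *s x + w) (a *s x + w) = c} = {w \<in> perp W x. B w w = c - fnorm a * B x x}"
        using B_eq_0_sym by (auto simp: perp_def fnorm_def algebra_simps)
      moreover have "c - fnorm a * B x x = 0 \<longleftrightarrow> a \<in> S" using x by (auto simp: S_def field_simps)
      moreover have "c - fnorm a * B x x \<in> fixed_field" using c Bxx by (simp add: fixed_field_iff)
      ultimately show "real (card {w \<in> perp W x. B (a *s x + w) (a *s x + w) = c})
          = (num_isotropic m - num_norm m) * of_bool (a \<in> S) + num_norm m"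
        using Suc.IH[OF W'] by simp
    qed
    also have "\<dots> = (num_isotropic m - num_norm m) * real (card S) + real q ^ 2 * num_norm m"
      by (simp add: sum.distrib card_field flip: sum_distrib_left)
    finally show ?thesis using S c by (simp add: num_recurrences)
  qed
qed

lemma card_nondegenerate:
  assumes "nondegenerate W" "vec.dim W = m"
  shows "card W = q ^ (2 * m)"
proof -
  have "real (card W) = (\<Sum>c\<in>fixed_field. real (card {z \<in> W. B z z = c}))"
    by (subst card_eq_sum_fibres[where f = "\<lambda>z. B z z" and C = fixed_field]) (use B_self_in_fixed_field in auto)
  also have "\<dots> = (\<Sum>c\<in>fixed_field. (num_isotropic m - num_norm m) * of_bool (c = 0) + num_norm m)"
    using card_by_norm[OF assms] by (intro sum.cong) auto
  also have "\<dots> = num_isotropic m + (real q - 1) * num_norm m"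
  proof -
    have "fixed_field \<inter> {c. c = 0} = {0}" by (auto simp: fixed_field_iff)
    then have "(\<Sum>c\<in>fixed_field. of_bool (c = 0)) = (1::real)" by (simp add: sum_of_bool_eq)
    then show ?thesis
      unfolding sum.distrib sum_distrib_left[symmetric] by (simp add: card_fixed_field algebra_simps)
  qed
  also have "\<dots> = real (q ^ (2 * m))"
    unfolding num_isotropic_def num_norm_def by (simp add: field_simps)
  finally show ?thesis by linarith
qed

text \<open>
Translation along \<open>p\<close> preserves the affine hyperplane \<open>B u p = t\<close> and changes \<open>B u u\<close> by an arbitrary
trace, so every element of the fixed field is the norm of equally many vectors of this hyperplane.
\<close>

lemma card_isotropic_meeting_isotropic:
  assumes W: "nondegenerate W" "vec.dim W = m" and p: "p \<in> W" "p \<noteq> 0" "B p p = 0" and t: "t \<noteq> 0"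
  shows "card {u \<in> W. B u u = 0 \<and> B u p = t} * q ^ 3 = q ^ (2 * m)"
proof -
  have sub: "vec.subspace W" using W by (simp add: nondegenerate_def)
  obtain y where y: "y \<in> W" "B p y \<noteq> 0" using W p by (auto simp: nondegenerate_def)
  \<comment> \<open>Translating by multiples of \<open>u0\<close> shows that all values of \<open>B u p\<close> are equally frequent.\<close>
  define u0 where "u0 = (1 / B y p) *s y"
  have u0: "u0 \<in> W" "B u0 p = 1"
    using y sub B_eq_0_sym by (auto simp: u0_def vec.subspace_scale)
  let ?T = "\<lambda>t. {u \<in> W. B u p = t}"
  have T: "card (?T t) = card (?T s)" for s
    by (rule card_Collect_translate[OF sub, where x = "(t - s) *s u0"])
      (use u0 sub in \<open>auto simp: vec.subspace_scale\<close>)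
  have "card W = (\<Sum>s\<in>UNIV. card (?T s))"
    by (rule card_eq_sum_fibres) auto
  also have "\<dots> = (\<Sum>s\<in>(UNIV::'a set). card (?T t))"
    by (intro sum.cong refl) (rule T[symmetric])
  also have "\<dots> = q ^ 2 * card (?T t)" by (simp add: card_field)
  finally have 1: "card W = q ^ 2 * card (?T t)" .
  have eq: "card {u \<in> W. B u u = c \<and> B u p = t} = card {u \<in> W. B u u = 0 \<and> B u p = t}"
    if c: "c \<in> fixed_field" for c
  proof -
    obtain a where a: "a + conjugate a = c" using trace_surj[OF c] .
    define s where "s = a / conjugate t"
    have s: "s * conjugate t + conjugate s * t = c" using a t by (simp add: s_def)
    have mem: "s *s p \<in> W" using p sub by (simp add: vec.subspace_scale)
    show ?thesis
    proof (rule card_Collect_translate[OF sub mem])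
      fix u assume "u \<in> W"
      have B': "B (u + s *s p) p = B u p" using p by simp
      have B_shift: "B (u + s *s p) (u + s *s p) = B u u + (s * conjugate (B u p) + conjugate s * B u p)"
        using p B_sym[of p u] by (simp add: algebra_simps)
      show "B (u + s *s p) (u + s *s p) = c \<and> B (u + s *s p) p = t \<longleftrightarrow> B u u = 0 \<and> B u p = t"
        unfolding B' B_shift using s by auto
    qed
  qed
  have "card (?T t) = (\<Sum>c\<in>fixed_field. card {u \<in> ?T t. B u u = c})"
    by (rule card_eq_sum_fibres) (use B_self_in_fixed_field in auto)
  also have "\<dots> = (\<Sum>c\<in>fixed_field. card {u \<in> W. B u u = c \<and> B u p = t})"
    by (intro sum.cong arg_cong[where f = card]) auto
  also have "\<dots> = q * card {u \<in> W. B u u = 0 \<and> B u p = t}" using eq by (simp add: card_fixed_field)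
  finally show ?thesis using 1 card_nondegenerate[OF W] by (simp add: power3_eq_cube power2_eq_square mult_ac)
qed

text \<open>
The value \<open>s\<close> determines the component \<open>(s / B y y) *s y\<close> of \<open>u\<close>; the component orthogonal to \<open>y\<close> ranges
over the vectors of one fixed non-zero norm.
\<close>

lemma card_isotropic_meeting_nonisotropic:
  assumes W: "nondegenerate W" "vec.dim W = Suc m" and y: "y \<in> W" "B y y \<noteq> 0" and s: "s \<noteq> 0"
  shows "real (card {u \<in> W. B u u = 0 \<and> B u y = s}) = num_norm m"
proof -
  have sub: "vec.subspace W" using W by (simp add: nondegenerate_def)
  have W': "nondegenerate (perp W y)" "vec.dim (perp W y) = m"
    using nondegenerate_perp[OF W(1) y] W(2) by auto
  let ?c = "- (fnorm (s / B y y) * B y y)"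
  have c: "?c \<noteq> 0" "?c \<in> fixed_field" using y s B_self_in_fixed_field by (auto simp: fixed_field_iff)
  have "card {u \<in> W. B u u = 0 \<and> B u y = s} = (\<Sum>a\<in>UNIV. card {w \<in> perp W y.
      B (a *s y + w) (a *s y + w) = 0 \<and> B (a *s y + w) y = s})"
    by (rule card_perp_decomposition[OF sub y])
  also have "\<dots> = (\<Sum>a\<in>UNIV. if a = s / B y y then card {w \<in> perp W y. B w w = ?c} else 0)"
  proof (intro sum.cong refl)
    fix a
    have "B (a *s y + w) y = s \<longleftrightarrow> a = s / B y y" if "w \<in> perp W y" for w
      using that y by (auto simp: perp_def field_simps)
    moreover have "B (a *s y + w) (a *s y + w) = 0 \<longleftrightarrow> B w w = - (fnorm a * B y y)" if "w \<in> perp W y" for w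
      using that B_eq_0_sym[of y w] by (simp add: perp_def fnorm_def eq_neg_iff_add_eq_0 algebra_simps)
    ultimately have "{w \<in> perp W y. B (a *s y + w) (a *s y + w) = 0 \<and> B (a *s y + w) y = s}
        = (if a = s / B y y then {w \<in> perp W y. B w w = ?c} else {})"
      by (cases "a = s / B y y") (auto simp del: B_left B_right fnorm_simps)
    then show "card {w \<in> perp W y. B (a *s y + w) (a *s y + w) = 0 \<and> B (a *s y + w) y = s}
        = (if a = s / B y y then card {w \<in> perp W y. B w w = ?c} else 0)" by simp
  qed
  also have "\<dots> = card {w \<in> perp W y. B w w = ?c}" by simp
  finally show ?thesis using card_by_norm[OF W'] c by simp
qed

section \<open>The graph on the non-isotropic points\<close>

lemma nonzero_if_B: "B z w \<noteq> 0 \<Longrightarrow> z \<noteq> 0"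
  by auto

lemma B_scale_self: "B (c *s z) (c *s z) = fnorm c * B z z"
  by (simp add: fnorm_def mult_ac)

lemma point_in_hermitian_variety_iff:
  assumes "x \<noteq> 0"
  shows "vec.span {x} \<in> hermitian_variety B \<longleftrightarrow> B x x = 0"
proof
  assume "vec.span {x} \<in> hermitian_variety B"
  then show "B x x = 0"
    unfolding hermitian_variety_def polar_def using vec.span_base[of x "{x}"] by blast
next
  assume 0: "B x x = 0"
  have "proj_point (vec.span {x})" using assms proj_point_iff by blast
  moreover have "B u w = 0" if "u \<in> vec.span {x}" "w \<in> vec.span {x}" for u w
    using that 0 unfolding in_span_singleton by auto
  ultimately show "vec.span {x} \<in> hermitian_variety B"
    unfolding hermitian_variety_def polar_def by blast
qed

lemma normalize:
  assumes "B x x \<noteq> 0"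
  obtains c where "c \<noteq> 0" "B (c *s x) (c *s x) = 1"
proof -
  have "1 / B x x \<in> fixed_field" using B_self_in_fixed_field[of x] by (simp add: fixed_field_iff)
  then obtain c where c: "fnorm c = 1 / B x x" by (rule norm_surj)
  have "c \<noteq> 0" using c assms by auto
  moreover have "B (c *s x) (c *s x) = fnorm c * B x x" by (simp add: fnorm_def)
  ultimately show thesis using that c assms by simp
qed

lemma NU_vertex_iff: "X \<in> pverts (NU_graph B) \<longleftrightarrow> (\<exists>x. B x x = 1 \<and> X = vec.span {x})"
proof
  assume "X \<in> pverts (NU_graph B)"
  then have "X \<in> points_of UNIV" "X \<notin> hermitian_variety B" by (simp_all add: NU_graph_def Let_def)
  moreover from this obtain x where x: "x \<noteq> 0" "X = vec.span {x}"
    using points_of_iff[OF vec.subspace_UNIV] by blast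
  ultimately have "B x x \<noteq> 0" using point_in_hermitian_variety_iff by blast
  obtain c where c: "c \<noteq> 0" "B (c *s x) (c *s x) = 1" using normalize[OF \<open>B x x \<noteq> 0\<close>] .
  moreover have "X = vec.span {c *s x}"
    using x c span_singleton_eq_iff by blast
  ultimately show "\<exists>x. B x x = 1 \<and> X = vec.span {x}" by blast
next
  assume "\<exists>x. B x x = 1 \<and> X = vec.span {x}"
  then obtain x where x: "B x x = 1" "X = vec.span {x}" by blast
  then have "x \<noteq> 0" by auto
  then have "X \<in> points_of UNIV" "X \<notin> hermitian_variety B"
    using x points_of_iff[OF vec.subspace_UNIV] point_in_hermitian_variety_iff by auto
  then show "X \<in> pverts (NU_graph B)" by (simp add: NU_graph_def Let_def)
qed

text \<open>
Replace \<open>y\<close> by its component \<open>y'\<close> orthogonal to \<open>x\<close>; the claim is that the line is tangent iff \<open>y'\<close> is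
isotropic.  If it is, then \<open>\<langle>y'\<rangle>\<close> is the only isotropic point of the line.  Otherwise the points
\<open>\<langle>a x + y'\<rangle>\<close> with \<open>fnorm a = - B y' y'\<close> are isotropic, and there are \<open>q + 1 > 1\<close> of them.
\<close>

lemma tangent_line_iff:
  assumes x: "B x x = 1" and y: "y \<notin> vec.span {x}"
  shows "tangent_line B (vec.span {x, y}) \<longleftrightarrow> B y y = fnorm (B y x)"
proof -
  define y' where "y' = y - B y x *s x"
  have x0: "x \<noteq> 0" using x by auto
  have y'0: "y' \<noteq> 0" using y by (auto simp: y'_def in_span_singleton)
  have y'x: "B y' x = 0" "B x y' = 0" using x B_sym[of x y] by (simp_all add: y'_def)
  have D: "B y' y' = B y y - fnorm (B y x)"
    using x B_sym[of x y] by (simp add: y'_def fnorm_def)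
  have mem: "z \<in> vec.span {x, y} \<longleftrightarrow> (\<exists>a c. z = a *s x + c *s y')" for z
  proof
    assume "z \<in> vec.span {x, y}"
    then obtain a c where "z = a *s x + c *s y" unfolding in_span_pair by blast
    then have "z = (a + c * B y x) *s x + c *s y'" by (simp add: y'_def vec.scale_right_diff_distrib vec.scale_left_distrib)
    then show "\<exists>a c. z = a *s x + c *s y'" by blast
  next
    assume "\<exists>a c. z = a *s x + c *s y'"
    then obtain a c where "z = a *s x + c *s y'" by blast
    then have "z = (a - c * B y x) *s x + c *s y" by (simp add: y'_def vec.scale_right_diff_distrib vec.scale_left_diff_distrib)
    then show "z \<in> vec.span {x, y}" unfolding in_span_pair by blast
  qed
  have Bz: "B (a *s x + c *s y') (a *s x + c *s y') = fnorm a + fnorm c * B y' y'" for a c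
    using x y'x by (simp add: fnorm_def)
  have line: "proj_line (vec.span {x, y})"
  proof -
    have "vec.independent {y, x}"
      using y x0 by (intro vec.independent_insertI) (simp_all add: vec.independent_empty)
    moreover have "y \<noteq> x" using y vec.span_base[of x "{x}"] by auto
    ultimately show ?thesis
      by (simp add: proj_line_def insert_commute vec.dim_eq_card_independent)
  qed
  let ?I = "points_of (vec.span {x, y}) \<inter> hermitian_variety B"
  have I: "X \<in> ?I \<longleftrightarrow> (\<exists>z. z \<noteq> 0 \<and> z \<in> vec.span {x, y} \<and> B z z = 0 \<and> X = vec.span {z})" for X
    using points_of_iff[OF vec.subspace_span[of "{x, y}"], of X] point_in_hermitian_variety_iff by auto
  show ?thesis
  proof (cases "B y' y' = 0")
    case True
    have "?I = {vec.span {y'}}"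
    proof (intro equalityI subsetI)
      fix X assume "X \<in> ?I"
      then obtain z where z: "z \<noteq> 0" "z \<in> vec.span {x, y}" "B z z = 0" "X = vec.span {z}"
        using I by blast
      then obtain a c where ac: "z = a *s x + c *s y'" using mem by blast
      then have "a = 0" using Bz[of a c] z True by simp
      then have "c \<noteq> 0" "z = c *s y'" using ac z by auto
      then show "X \<in> {vec.span {y'}}" using z(4) y'0 span_singleton_eq_iff by blast
    next
      fix X assume "X \<in> {vec.span {y'}}"
      moreover have "y' \<in> vec.span {x, y}" using mem[of y'] by (metis add.left_neutral vec.scale_one vec.scale_zero_left)
      ultimately show "X \<in> ?I" using I True y'0 by blast
    qed
    then show ?thesis using True D line by (simp add: tangent_line_def)
  next
    case False
    have fixed_field: "- B y' y' \<in> fixed_field" using B_self_in_fixed_field[of y'] by (simp add: fixed_field_iff)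
    have "card {a. fnorm a = - B y' y'} \<ge> 2" using card_norm_fibre[OF fixed_field] False q_ge_2 by simp
    then have "\<not> card {a. fnorm a = - B y' y'} \<le> Suc 0" by simp
    then obtain a b where ab: "fnorm a = - B y' y'" "fnorm b = - B y' y'" "a \<noteq> b"
      unfolding card_le_Suc0_iff_eq[OF finite] by blast
    have in_I: "vec.span {c *s x + y'} \<in> ?I" if "fnorm c = - B y' y'" for c
    proof -
      have "B (c *s x + y') y' = B y' y'" using y'x by simp
      then have "c *s x + y' \<noteq> 0" using False nonzero_if_B by metis
      moreover have "c *s x + y' \<in> vec.span {x, y}" using mem[of "c *s x + y'"] by (metis vec.scale_one)
      moreover have "B (c *s x + y') (c *s x + y') = 0" using Bz[of c 1] that by simp
      ultimately show ?thesis using I by blast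
    qed
    have "vec.span {a *s x + y'} \<noteq> vec.span {b *s x + y'}"
    proof
      assume eq: "vec.span {a *s x + y'} = vec.span {b *s x + y'}"
      then have "b *s x + y' \<in> vec.span {a *s x + y'}" using vec.span_base by blast
      then obtain c where c: "b *s x + y' = c *s (a *s x + y')" unfolding in_span_singleton by blast
      have "B (b *s x + y') y' = B (c *s (a *s x + y')) y'" "B (b *s x + y') x = B (c *s (a *s x + y')) x"
        using c by simp_all
      then show False using False ab(3) x y'x by simp
    qed
    then have "card ?I \<noteq> 1" using in_I[OF ab(1)] in_I[OF ab(2)] by (metis card_1_singletonE singletonD)
    then show ?thesis using False D by (simp add: tangent_line_def)
  qed
qed

lemma NU_adjacent_iff:
  assumes x: "B x x = 1" and y: "B y y = 1"
  shows "(vec.span {x}, vec.span {y}) \<in> parcs (NU_graph B) \<longleftrightarrow>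
    vec.span {x} \<noteq> vec.span {y} \<and> fnorm (B x y) = 1"
proof -
  have "vec.span {x} \<in> pverts (NU_graph B)" "vec.span {y} \<in> pverts (NU_graph B)"
    using NU_vertex_iff x y by blast+
  then have arc: "(vec.span {x}, vec.span {y}) \<in> parcs (NU_graph B) \<longleftrightarrow>
    vec.span {x} \<noteq> vec.span {y} \<and> tangent_line B (vec.span {x, y})"
    unfolding NU_graph_def Let_def by (simp add: proj_join_points)
  show ?thesis
  proof (cases "vec.span {x} = vec.span {y}")
    case False
    have "y \<notin> vec.span {x}"
    proof
      assume "y \<in> vec.span {x}"
      then obtain c where c: "y = c *s x" unfolding in_span_singleton by blast
      then have "c \<noteq> 0" "x \<noteq> 0" using x y by auto
      then show False using False c span_singleton_eq_iff by blast
    qed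
    then have "tangent_line B (vec.span {x, y}) \<longleftrightarrow> fnorm (B y x) = 1"
      using tangent_line_iff[OF x] y by auto
    then show ?thesis using arc B_sym[of x y] by simp
  qed (use arc in simp)
qed

lemma pair_graph_NU: "pair_graph (NU_graph B)"
proof -
  have fin: "finite (pverts (NU_graph B))" by (simp add: NU_graph_def Let_def)
  have sub: "parcs (NU_graph B) \<subseteq> pverts (NU_graph B) \<times> pverts (NU_graph B)"
    by (auto simp: NU_graph_def Let_def)
  have "(w, u) \<in> parcs (NU_graph B) \<and> u \<noteq> w" if "(u, w) \<in> parcs (NU_graph B)" for u w
    using that by (auto simp: NU_graph_def Let_def proj_join_def Un_commute)
  with fin sub show ?thesis unfolding pair_graph_iff by blast
qed

text \<open>
Each non-isotropic point is spanned by exactly \<open>q + 1\<close> vectors of norm \<open>1\<close>.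
\<close>

lemma card_NU_vertices:
  assumes "CARD('n) = Suc n"
  shows "(real q + 1) * real (card (pverts (NU_graph B))) = num_norm (Suc n)"
proof -
  let ?S = "{z \<in> UNIV. B z z = 1}" and ?f = "\<lambda>x. vec.span {x}"
  have V: "pverts (NU_graph B) = ?f ` ?S"
    by (rule set_eqI) (simp add: NU_vertex_iff image_iff)
  have fibre: "card {z \<in> ?S. ?f z = X} = q + 1" if X: "X \<in> pverts (NU_graph B)" for X
  proof -
    obtain x where x: "B x x = 1" "X = vec.span {x}" using X NU_vertex_iff by blast
    have x0: "x \<noteq> 0" using x by auto
    have "{z \<in> ?S. ?f z = X} = (\<lambda>c. c *s x) ` {c. fnorm c = 1}"
    proof (intro equalityI subsetI)
      fix z assume "z \<in> {z \<in> ?S. ?f z = X}"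
      then have z: "B z z = 1" "vec.span {x} = vec.span {z}" using x by auto
      then obtain c where c: "z = c *s x" using span_singleton_eq_iff[OF x0] by blast
      then have "fnorm c = 1" using z(1) x(1) B_scale_self[of c x] by simp
      with c show "z \<in> (\<lambda>c. c *s x) ` {c. fnorm c = 1}" by blast
    next
      fix z assume "z \<in> (\<lambda>c. c *s x) ` {c. fnorm c = 1}"
      then obtain c where c: "fnorm c = 1" "z = c *s x" by blast
      then have "c \<noteq> 0" by auto
      then have "vec.span {x} = vec.span {z}" using c span_singleton_eq_iff[OF x0] by blast
      moreover have "B z z = 1" using c x(1) B_scale_self[of c x] by simp
      ultimately show "z \<in> {z \<in> ?S. ?f z = X}" using x by simp
    qed
    moreover have "inj (\<lambda>c. c *s x)" using x0 by (auto simp: inj_on_def)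
    moreover have "card {c. fnorm c = 1} = q + 1" by (rule card_norm_fibre) (auto simp: fixed_field_iff)
    ultimately show ?thesis by (simp add: card_image inj_on_subset)
  qed
  have "card ?S = (\<Sum>X\<in>pverts (NU_graph B). card {z \<in> ?S. ?f z = X})"
    using V by (intro card_eq_sum_fibres) (simp_all add: NU_graph_def Let_def)
  also have "\<dots> = (q + 1) * card (pverts (NU_graph B))" using fibre by simp
  finally have "real (card ?S) = (real q + 1) * real (card (pverts (NU_graph B)))"
    by (simp add: algebra_simps)
  moreover have "real (card ?S) = num_norm (Suc n)"
    using card_by_norm[OF nondegenerate_UNIV, of "Suc n" 1] assms by (simp add: vec.dim_UNIV card_cart_basis fixed_field_iff)
  ultimately show ?thesis by simp
qed

text \<open>
A neighbour of \<open>\<langle>x\<rangle>\<close> is spanned by a vector \<open>z\<close> of norm \<open>1\<close> for which \<open>B z x\<close> has field norm \<open>1\<close>.  There is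
a unique multiple of \<open>z\<close> by which it may be replaced to get \<open>B z x = 1\<close>, and then \<open>z - x\<close> is isotropic and orthogonal to \<open>x\<close>.
\<close>

lemma NU_neighbourhood:
  assumes x: "B x x = 1"
  shows "neighbourhood (NU_graph B) (vec.span {x})
    = (\<lambda>u. vec.span {x + u}) ` {u \<in> perp UNIV x. B u u = 0 \<and> u \<noteq> 0}" (is "?N = ?f ` ?U")
    and "inj_on (\<lambda>u. vec.span {x + u}) (perp UNIV x)"
    and "u \<in> perp UNIV x \<Longrightarrow> B u u = 0 \<Longrightarrow> B (x + u) (x + u) = 1"
proof -
  show inj: "inj_on ?f (perp UNIV x)"
  proof (rule inj_onI)
    fix u w assume u: "u \<in> perp UNIV x" "w \<in> perp UNIV x" and eq: "?f u = ?f w"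
    have "B (x + u) x = 1" using x u by (simp add: perp_def)
    then have "x + u \<noteq> 0" using nonzero_if_B[of "x + u" x] by (metis one_neq_zero)
    then obtain c where c: "x + w = c *s (x + u)" using span_singleton_eq_iff eq by blast
    then have "B (x + w) x = B (c *s (x + u)) x" by simp
    then have "c = 1" using u x by (simp add: perp_def)
    then show "u = w" using c by simp
  qed
  have norm: "B (x + u) (x + u) = 1" if "u \<in> perp UNIV x" "B u u = 0" for u
    using x that B_sym[of x u] by (simp add: perp_def)
  show "u \<in> perp UNIV x \<Longrightarrow> B u u = 0 \<Longrightarrow> B (x + u) (x + u) = 1" by (rule norm)
  show "?N = ?f ` ?U"
  proof (intro equalityI subsetI)
    fix Z assume Z: "Z \<in> ?N"
    then have "Z \<in> pverts (NU_graph B)" using pair_graph_NU pair_graph_iff by fastforce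
    then obtain z where z: "B z z = 1" "Z = vec.span {z}" using NU_vertex_iff by blast
    then have ne: "Z \<noteq> vec.span {x}" and "fnorm (B x z) = 1" using Z NU_adjacent_iff[OF x z(1)] by auto
    then have 1: "fnorm (B z x) = 1" using B_sym[of z x] by simp
    define c where "c = 1 / B z x"
    have c: "c \<noteq> 0" "fnorm c = 1" "c * B z x = 1" using 1 by (auto simp: c_def)
    define u where "u = c *s z - x"
    have "B u x = 0" using c x by (simp add: u_def)
    then have perp: "u \<in> perp UNIV x" by (simp add: perp_def)
    have "B (c *s z) (c *s z) = 1" using c(2) z(1) B_scale_self[of c z] by simp
    moreover have diff: "B (w - x) (w - x) = B w w - 1" if "B w x = 1" for w
      using that x B_sym[of x w] by simp
    have "B u u = B (c *s z) (c *s z) - 1" unfolding u_def by (rule diff) (simp add: c(3))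
    ultimately have "B u u = 0" by simp
    moreover have "z \<noteq> 0" using z by auto
    then have Z': "Z = vec.span {x + u}"
      unfolding z(2) using span_singleton_eq_iff c(1) by (auto simp: u_def)
    moreover have "u \<noteq> 0" using Z' ne by auto
    ultimately show "Z \<in> ?f ` ?U" using perp by blast
  next
    fix Z assume "Z \<in> ?f ` ?U"
    then obtain u where u: "u \<in> perp UNIV x" "B u u = 0" "u \<noteq> 0" "Z = vec.span {x + u}" by blast
    have "0 \<in> perp UNIV x" by (simp add: perp_def)
    then have "?f 0 \<noteq> ?f u" using inj u unfolding inj_on_def by metis
    then have "vec.span {x} \<noteq> vec.span {x + u}" by simp
    moreover have "fnorm (B x (x + u)) = 1" using u x B_sym[of x u] by (simp add: perp_def)
    ultimately show "Z \<in> ?N" using NU_adjacent_iff[OF x norm] u by simp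
  qed
qed

lemma nondegenerate_perp_UNIV:
  assumes "B x x = 1" "CARD('n) = Suc n"
  shows "nondegenerate (perp UNIV x)" "vec.dim (perp UNIV x) = n"
proof -
  have "vec.dim (UNIV :: ('a ^ 'n) set) = Suc n"
    using assms(2) by (simp add: vec.dim_UNIV card_cart_basis)
  then show "nondegenerate (perp UNIV x)" "vec.dim (perp UNIV x) = n"
    using nondegenerate_perp[OF nondegenerate_UNIV UNIV_I, of x] assms(1) by auto
qed

lemma card_NU_neighbourhood:
  assumes X: "X \<in> pverts (NU_graph B)" and n: "CARD('n) = Suc n"
  shows "real (card (neighbourhood (NU_graph B) X)) = num_isotropic n - 1"
proof -
  obtain x where x: "B x x = 1" "X = vec.span {x}" using X NU_vertex_iff by blast
  let ?U = "{u \<in> perp UNIV x. B u u = 0}"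
  have "card (neighbourhood (NU_graph B) X) = card {u \<in> perp UNIV x. B u u = 0 \<and> u \<noteq> 0}"
    unfolding x(2) NU_neighbourhood(1)[OF x(1)]
    by (intro card_image inj_on_subset[OF NU_neighbourhood(2)[OF x(1)]]) auto
  also have "{u \<in> perp UNIV x. B u u = 0 \<and> u \<noteq> 0} = ?U - {0}" by auto
  finally have "card (neighbourhood (NU_graph B) X) = card (?U - {0})" .
  moreover have "0 \<in> ?U" by (simp add: perp_def)
  then have "card ?U = Suc (card (?U - {0}))" by (intro card.remove) simp_all
  then have "real (card (?U - {0})) = real (card ?U) - 1" by linarith
  ultimately show ?thesis using card_by_norm[OF nondegenerate_perp_UNIV[OF x(1) n], of 0] by simp
qed

text \<open>
In terms of the component \<open>y'\<close> of \<open>y\<close> orthogonal to \<open>x\<close>, adjacency of \<open>\<langle>x + u\<rangle>\<close> and \<open>\<langle>y\<rangle>\<close> is a condition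
on the single field element \<open>B u y'\<close>.
\<close>

lemma card_NU_common_neighbours:
  assumes x: "B x x = 1" and y: "B y y = 1"
  defines "y' \<equiv> y - B y x *s x"
  shows "card (neighbourhood (NU_graph B) (vec.span {x}) \<inter> neighbourhood (NU_graph B) (vec.span {y}))
    = card {u \<in> perp UNIV x. B u u = 0 \<and> fnorm (B x y + B u y') = 1 \<and> u \<noteq> 0 \<and> vec.span {x + u} \<noteq> vec.span {y}}"
proof -
  let ?U = "{u \<in> perp UNIV x. B u u = 0 \<and> fnorm (B x y + B u y') = 1 \<and> u \<noteq> 0 \<and> vec.span {x + u} \<noteq> vec.span {y}}"
  have "vec.span {x + u} \<in> neighbourhood (NU_graph B) (vec.span {y}) \<longleftrightarrow>
      fnorm (B x y + B u y') = 1 \<and> vec.span {x + u} \<noteq> vec.span {y}"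
    if u: "u \<in> perp UNIV x" "B u u = 0" for u
  proof -
    have "B (x + u) y = B x y + B u y'" using u by (simp add: y'_def perp_def)
    moreover have "fnorm (B y (x + u)) = fnorm (B (x + u) y)" using B_sym[of y "x + u"] by (metis fnorm_simps(5))
    ultimately show ?thesis
      using NU_adjacent_iff[OF y NU_neighbourhood(3)[OF x u]] by auto
  qed
  then have "neighbourhood (NU_graph B) (vec.span {x}) \<inter> neighbourhood (NU_graph B) (vec.span {y})
    = (\<lambda>u. vec.span {x + u}) ` ?U"
    unfolding NU_neighbourhood(1)[OF x] by auto
  moreover have "inj_on (\<lambda>u. vec.span {x + u}) ?U"
    by (rule inj_on_subset[OF NU_neighbourhood(2)[OF x]]) auto
  ultimately show ?thesis by (simp add: card_image)
qed

lemma card_norm_translate: "card {t. fnorm (b + t) = 1} = q + 1"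
proof -
  have "card {t. fnorm (b + t) = 1} = card {t. fnorm t = 1}"
    by (rule bij_betw_same_card[OF bij_betw_byWitness[where f = "\<lambda>t. b + t" and f' = "\<lambda>t. t - b"]]) auto
  then show ?thesis using card_norm_fibre[of 1] by (simp add: fixed_field_iff)
qed

lemma card_by_value:
  "card {u \<in> W. P u \<and> Q (B u y)} = (\<Sum>t\<in>{t. Q t}. card {u \<in> W. P u \<and> B u y = t})"
proof -
  have "card {u \<in> W. P u \<and> Q (B u y)}
      = (\<Sum>t\<in>{t. Q t}. card {u \<in> {u \<in> W. P u \<and> Q (B u y)}. B u y = t})"
    by (rule card_eq_sum_fibres) auto
  also have "\<dots> = (\<Sum>t\<in>{t. Q t}. card {u \<in> W. P u \<and> B u y = t})"
    by (intro sum.cong arg_cong[where f = card]) auto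
  finally show ?thesis .
qed

text \<open>
Here \<open>y'\<close> is not isotropic, and none of the \<open>q + 1\<close> admissible values of \<open>B u y'\<close> is zero; so each of them is
attained by the same number of isotropic vectors.
\<close>

lemma card_NU_common_nonadjacent:
  assumes x: "B x x = 1" and y: "B y y = 1" and n: "CARD('n) = Suc (Suc m)"
    and nonadj: "fnorm (B x y) \<noteq> 1"
  shows "real (card (neighbourhood (NU_graph B) (vec.span {x}) \<inter> neighbourhood (NU_graph B) (vec.span {y})))
    = (real q + 1) * num_norm m"
proof -
  define y' where "y' = y - B y x *s x"
  define T where "T = {t. fnorm (B x y + t) = 1}"
  have yx: "fnorm (B y x) = fnorm (B x y)" using B_sym[of y x] by simp
  have y': "y' \<in> perp UNIV x" using x by (simp add: y'_def perp_def)
  have "B y' y' = 1 - fnorm (B y x)" using x y B_sym[of x y] by (simp add: y'_def fnorm_def)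
  then have D: "B y' y' \<noteq> 0" using nonadj yx by simp
  have "fnorm (B x y + B u y') = 1 \<Longrightarrow> u \<noteq> 0" for u using nonadj by auto
  moreover have "vec.span {x + u} \<noteq> vec.span {y}" if u: "u \<in> perp UNIV x" "B u u = 0" for u
  proof
    assume eq: "vec.span {x + u} = vec.span {y}"
    have norm: "B (x + u) (x + u) = 1" using NU_neighbourhood(3)[OF x u] .
    then have "x + u \<noteq> 0" using nonzero_if_B[of "x + u"] by (metis one_neq_zero)
    then obtain c where c: "y = c *s (x + u)" using eq span_singleton_eq_iff by blast
    have "B y y = fnorm c * B (x + u) (x + u)" unfolding c by (rule B_scale_self)
    then have "fnorm c = 1" using norm y by simp
    moreover have "B y x = c" unfolding c using x u by (simp add: perp_def)
    ultimately show False using nonadj yx by simp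
  qed
  ultimately have "{u \<in> perp UNIV x. B u u = 0 \<and> fnorm (B x y + B u y') = 1 \<and> u \<noteq> 0 \<and> vec.span {x + u} \<noteq> vec.span {y}}
     = {u \<in> perp UNIV x. B u u = 0 \<and> fnorm (B x y + B u y') = 1}" by blast
  then have "card (neighbourhood (NU_graph B) (vec.span {x}) \<inter> neighbourhood (NU_graph B) (vec.span {y}))
     = card {u \<in> perp UNIV x. B u u = 0 \<and> fnorm (B x y + B u y') = 1}"
    unfolding card_NU_common_neighbours[OF x y, folded y'_def] by simp
  also have "\<dots> = (\<Sum>t\<in>T. card {u \<in> perp UNIV x. B u u = 0 \<and> B u y' = t})"
    unfolding T_def by (rule card_by_value)
  finally have "real (card (neighbourhood (NU_graph B) (vec.span {x}) \<inter> neighbourhood (NU_graph B) (vec.span {y})))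
     = (\<Sum>t\<in>T. real (card {u \<in> perp UNIV x. B u u = 0 \<and> B u y' = t}))" by simp
  also have "\<dots> = (\<Sum>t\<in>T. num_norm m)"
  proof (intro sum.cong refl)
    fix t assume "t \<in> T"
    then have "t \<noteq> 0" using nonadj by (auto simp: T_def)
    then show "real (card {u \<in> perp UNIV x. B u u = 0 \<and> B u y' = t}) = num_norm m"
      by (rule card_isotropic_meeting_nonisotropic[OF nondegenerate_perp_UNIV[OF x n] y' D])
  qed
  also have "\<dots> = (real q + 1) * num_norm m" by (simp add: T_def card_norm_translate)
  finally show ?thesis .
qed

text \<open>
Here \<open>y'\<close> is isotropic and \<open>0\<close> is one of the \<open>q + 1\<close> admissible values of \<open>B u y'\<close>.  The other \<open>q\<close> values
occur \<open>q ^ (2 * n - 3)\<close> times each; the value \<open>0\<close> accounts for the isotropic vectors on which none of the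
\<open>q\<^sup>2 - 1\<close> non-zero values is attained.  The summand \<open>- 2\<close> removes the two vectors \<open>u\<close> that yield \<open>\<langle>x\<rangle>\<close> and
\<open>\<langle>y\<rangle>\<close> themselves.
\<close>

lemma card_NU_common_adjacent:
  assumes x: "B x x = 1" and y: "B y y = 1" and n: "CARD('n) = Suc n" "n \<ge> 2"
    and adj: "fnorm (B x y) = 1" and ne: "vec.span {x} \<noteq> vec.span {y}"
  shows "real (card (neighbourhood (NU_graph B) (vec.span {x}) \<inter> neighbourhood (NU_graph B) (vec.span {y})))
    = num_isotropic n - (real q ^ 2 - 1) * real q ^ (2 * n - 3) + real q * real q ^ (2 * n - 3) - 2"
proof -
  define y' where "y' = y - B y x *s x"
  define T where "T = {t. fnorm (B x y + t) = 1}"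
  have x0: "x \<noteq> 0" using x by auto
  have yx: "fnorm (B y x) = 1" using B_sym[of y x] adj by simp
  then have yx0: "B y x \<noteq> 0" by auto
  note W = nondegenerate_perp_UNIV[OF x n(1)]
  have sub: "vec.subspace (perp UNIV x)" using W by (simp add: nondegenerate_def)
  have y': "y' \<in> perp UNIV x" using x by (simp add: y'_def perp_def)
  have y'0: "y' \<noteq> 0"
  proof
    assume "y' = 0"
    then have "y = B y x *s x" by (simp add: y'_def)
    then show False using ne yx0 span_singleton_eq_iff[OF x0] by blast
  qed
  have y'iso: "B y' y' = 0" using x y yx B_sym[of x y] by (simp add: y'_def fnorm_def)
  let ?f = "\<lambda>t. card {u \<in> perp UNIV x. B u u = 0 \<and> B u y' = t}"
  have f: "real (?f t) = real q ^ (2 * n - 3)" if "t \<noteq> 0" for t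
  proof -
    have "q ^ (2 * n) = q ^ (2 * n - 3) * q ^ 3" using n(2) by (simp flip: power_add)
    then have "?f t = q ^ (2 * n - 3)"
      using card_isotropic_meeting_isotropic[OF W y' y'0 y'iso that] by simp
    then show ?thesis by simp
  qed
  have all: "num_isotropic n = real (?f 0) + (real q ^ 2 - 1) * real q ^ (2 * n - 3)"
  proof -
    have "card {u \<in> perp UNIV x. B u u = 0 \<and> True} = (\<Sum>t\<in>{t. True}. ?f t)"
      by (rule card_by_value)
    then have "num_isotropic n = (\<Sum>t\<in>UNIV. real (?f t))" using card_by_norm[OF W, of 0] by simp
    also have "\<dots> = real (?f 0) + (\<Sum>t\<in>UNIV - {0}. real (?f t))" by (rule sum.remove) auto
    also have "(\<Sum>t\<in>UNIV - {0}. real (?f t)) = (\<Sum>t\<in>UNIV - {0::'a}. real q ^ (2 * n - 3))"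
      by (intro sum.cong refl f) auto
    also have "\<dots> = (real q ^ 2 - 1) * real q ^ (2 * n - 3)"
      using q_ge_2 by (simp add: card_Diff_singleton card_field of_nat_diff)
    finally show ?thesis .
  qed
  let ?S = "{u \<in> perp UNIV x. B u u = 0 \<and> fnorm (B x y + B u y') = 1}"
  have S: "real (card ?S) = real (?f 0) + real q * real q ^ (2 * n - 3)"
  proof -
    have "card ?S = (\<Sum>t\<in>T. ?f t)" unfolding T_def by (rule card_by_value)
    then have "real (card ?S) = (\<Sum>t\<in>T. real (?f t))" by simp
    also have "\<dots> = real (?f 0) + (\<Sum>t\<in>T - {0}. real (?f t))"
      using adj by (intro sum.remove) (auto simp: T_def)
    also have "(\<Sum>t\<in>T - {0}. real (?f t)) = (\<Sum>t\<in>T - {0}. real q ^ (2 * n - 3))"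
      by (intro sum.cong refl f) auto
    also have "card (T - {0}) = q"
      using adj card_norm_translate[of "B x y"] by (simp add: T_def card_Diff_singleton)
    then have "(\<Sum>t\<in>T - {0}. real q ^ (2 * n - 3)) = real q * real q ^ (2 * n - 3)" by simp
    finally show ?thesis .
  qed
  \<comment> \<open>The vector for which \<open>x + u1\<close> spans the point \<open>\<langle>y\<rangle>\<close>.\<close>
  define u1 where "u1 = (1 / B y x) *s y'"
  have u1: "u1 \<in> perp UNIV x" "B u1 u1 = 0" "B u1 y' = 0" "u1 \<noteq> 0"
    using y' y'iso y'0 yx0 sub by (auto simp: u1_def vec.subspace_scale)
  have span_iff: "vec.span {x + u} = vec.span {y} \<longleftrightarrow> u = u1" if u: "u \<in> perp UNIV x" for u
  proof
    assume eq: "vec.span {x + u} = vec.span {y}"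
    have xu: "B (x + u) x = 1" using u x by (simp add: perp_def)
    then have "x + u \<noteq> 0" using nonzero_if_B[of "x + u"] by (metis one_neq_zero)
    then obtain c where c: "y = c *s (x + u)" using eq span_singleton_eq_iff by blast
    have "B y x = c" unfolding c using xu by (simp only: B_left mult_1_right)
    then have "y' = B y x *s u" using c by (simp add: y'_def vec.scale_right_distrib)
    then show "u = u1" using yx0 by (simp add: u1_def)
  next
    assume "u = u1"
    then have "y = B y x *s (x + u)" using yx0 by (simp add: u1_def y'_def vec.scale_right_distrib)
    moreover have "B (x + u) x = 1" using u x by (simp add: perp_def)
    then have "x + u \<noteq> 0" using nonzero_if_B[of "x + u"] by (metis one_neq_zero)
    ultimately show "vec.span {x + u} = vec.span {y}" using yx0 span_singleton_eq_iff by blast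
  qed
  have "{u \<in> perp UNIV x. B u u = 0 \<and> fnorm (B x y + B u y') = 1 \<and> u \<noteq> 0 \<and> vec.span {x + u} \<noteq> vec.span {y}}
     = ?S - {0, u1}" using span_iff by blast
  then have "card (neighbourhood (NU_graph B) (vec.span {x}) \<inter> neighbourhood (NU_graph B) (vec.span {y}))
     = card (?S - {0, u1})"
    unfolding card_NU_common_neighbours[OF x y, folded y'_def] by simp
  moreover have sub2: "{0, u1} \<subseteq> ?S" using u1 adj by (simp add: perp_def)
  moreover have c2: "card {0, u1} = 2" using u1(4) by (simp add: card_insert_if)
  ultimately have "card (neighbourhood (NU_graph B) (vec.span {x}) \<inter> neighbourhood (NU_graph B) (vec.span {y}))
     = card ?S - 2" by (simp add: card_Diff_subset)
  moreover have "card ?S \<ge> 2" using card_mono[OF _ sub2] c2 by simp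
  ultimately show ?thesis using S all by (simp add: of_nat_diff)
qed

lemma num_norm_pos: "m > 0 \<Longrightarrow> num_norm m > 0"
proof -
  assume m: "m > 0"
  have "(-1) ^ m * real q ^ m \<le> real q ^ m" by (cases "even m") simp_all
  also have "real q ^ m < real q ^ (2 * m)" using q_ge_2 m by (intro power_strict_increasing) auto
  finally show ?thesis by (simp add: num_norm_def)
qed

proposition strongly_regular_NU_graph:
  assumes n: "CARD('n) = Suc n" "n \<ge> 2"
    and v: "(real q + 1) * real v = num_norm (Suc n)"
    and k: "real k = num_isotropic n - 1"
    and lam: "real lam = num_isotropic n - (real q ^ 2 - 1) * real q ^ (2 * n - 3) + real q * real q ^ (2 * n - 3) - 2"
    and mu: "real mu = (real q + 1) * num_norm (n - 1)"
  shows "strongly_regular (NU_graph B) v k lam mu"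
proof -
  let ?G = "NU_graph B"
  have mu0: "mu > 0"
  proof -
    have "real mu > 0" unfolding mu using num_norm_pos[of "n - 1"] n(2) by (intro mult_pos_pos) auto
    then show ?thesis by simp
  qed
  have "(real q + 1) * real (card (pverts ?G)) = (real q + 1) * real v"
    using card_NU_vertices[OF n(1)] v by simp
  moreover have q1: "real q + 1 > 0" by simp
  ultimately have card_V: "card (pverts ?G) = v"
    by (metis mult_left_cancel of_nat_eq_iff less_irrefl)
  have common: "card (neighbourhood ?G X \<inter> neighbourhood ?G Y) = (if (X, Y) \<in> parcs ?G then lam else mu)"
    if X: "X \<in> pverts ?G" and Y: "Y \<in> pverts ?G" and ne: "X \<noteq> Y" for X Y
  proof -
    obtain x where x: "B x x = 1" "X = vec.span {x}" using X NU_vertex_iff by blast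
    obtain y where y: "B y y = 1" "Y = vec.span {y}" using Y NU_vertex_iff by blast
    have adj: "(X, Y) \<in> parcs ?G \<longleftrightarrow> fnorm (B x y) = 1"
      using NU_adjacent_iff[OF x(1) y(1)] x y ne by simp
    show ?thesis
    proof (cases "fnorm (B x y) = 1")
      case True
      then have "real (card (neighbourhood ?G X \<inter> neighbourhood ?G Y)) = real lam"
        using card_NU_common_adjacent[OF x(1) y(1) n True] ne x y lam by simp
      then show ?thesis using True adj by simp
    next
      case False
      have "CARD('n) = Suc (Suc (n - 1))" using n by simp
      then have "real (card (neighbourhood ?G X \<inter> neighbourhood ?G Y)) = real mu"
        using card_NU_common_nonadjacent[OF x(1) y(1) _ False] x y mu by simp
      then show ?thesis using False adj by simp
    qed
  qed
  have "v > 0" using v num_norm_pos[of "Suc n"] by (cases v) auto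
  then have "pverts ?G \<noteq> {}" using card_V by auto
  then have "Digraph_Component.connected (with_proj ?G)"
    using common mu0 by (intro connected_if_common_neighbours[OF pair_graph_NU]) fastforce+
  moreover have "card (neighbourhood ?G X) = k" if "X \<in> pverts ?G" for X
    using card_NU_neighbourhood[OF that n(1)] k by simp
  moreover have "X \<noteq> Y" if "(X, Y) \<in> parcs ?G" for X Y
    using pair_graph_NU that pair_graph_iff by blast
  ultimately show ?thesis
    unfolding strongly_regular_def using pair_graph_NU card_V common by auto
qed

section \<open>Switching with respect to two lines through an isotropic point\<close>

definition punctured_line :: "'a ^ 'n \<Rightarrow> 'a ^ 'n \<Rightarrow> ('a ^ 'n) set set" where
  "punctured_line p x = range (\<lambda>a. vec.span {x + a *s p})"

text \<open>
If some \<open>z\<close> on the line were not orthogonal to \<open>p\<close>, the norm of \<open>z + c *s p\<close> would run through the whole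
fixed field, and the line would contain an isotropic point other than \<open>P\<close>.
\<close>

lemma isotropic_line_param:
  assumes L: "proj_line L" and P: "points_of L \<inter> hermitian_variety B = {P}"
    and p: "P = vec.span {p}" "p \<noteq> 0"
  obtains x where "B x x = 1" "B x p = 0" "L = vec.span {p, x}" "points_of L - {P} = punctured_line p x"
proof -
  have sub: "vec.subspace L" and dim: "vec.dim L = 2" using L by (simp_all add: proj_line_def)
  have "P \<in> points_of L" "P \<in> hermitian_variety B" using P by auto
  then have pL: "p \<in> L" and pp: "B p p = 0"
    using p vec.span_base[of p "{p}"] point_in_hermitian_variety_iff by (auto simp: points_of_def)
  have iso: "z \<in> vec.span {p}" if "z \<in> L" "B z z = 0" for z
  proof (cases "z = 0")
    case True
    then show ?thesis by (simp add: vec.span_zero)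
  next
    case False
    have "vec.span {z} \<in> points_of L" using False that points_of_iff[OF sub] by blast
    moreover have "vec.span {z} \<in> hermitian_variety B"
      using False that point_in_hermitian_variety_iff by blast
    ultimately have "vec.span {z} = vec.span {p}" using P p by blast
    then show ?thesis using vec.span_base[of z "{z}"] by simp
  qed
  have "\<exists>z\<in>L. z \<notin> vec.span {p}"
  proof (rule ccontr)
    assume "\<not> ?thesis"
    then have "vec.dim L \<le> vec.dim (vec.span {p})" by (intro vec.dim_subset) blast
    then show False using dim p by simp
  qed
  then obtain z where z: "z \<in> L" "z \<notin> vec.span {p}" by blast
  have shift: "z + c *s p \<in> L" "z + c *s p \<notin> vec.span {p}" for c
  proof -
    show "z + c *s p \<in> L" using z pL sub by (simp add: vec.subspace_add vec.subspace_scale)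
    have "c *s p \<in> vec.span {p}" by (simp add: vec.span_base vec.span_scale)
    then show "z + c *s p \<notin> vec.span {p}" using z(2) vec.span_add_eq2[of "c *s p"] by blast
  qed
  have zz: "B z z \<noteq> 0" using iso z by blast
  have zp: "B z p = 0"
  proof (rule ccontr)
    assume zp: "B z p \<noteq> 0"
    have "- B z z \<in> fixed_field" using B_self_in_fixed_field[of z] by (simp add: fixed_field_iff)
    then obtain a where a: "a + conjugate a = - B z z" by (rule trace_surj)
    \<comment> \<open>With this \<open>c\<close> the cross terms of the norm of \<open>z + c *s p\<close> cancel \<open>B z z\<close>.\<close>
    define c where "c = a / conjugate (B z p)"
    have "B (z + c *s p) (z + c *s p) = B z z + (c * conjugate (B z p) + conjugate (c * conjugate (B z p)))"
      using pp B_sym[of p z] by (simp add: algebra_simps)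
    also have "c * conjugate (B z p) = a" using zp by (simp add: c_def)
    finally have "B (z + c *s p) (z + c *s p) = 0" using a by simp
    then show False using iso shift by blast
  qed
  obtain c where c: "c \<noteq> 0" "B (c *s z) (c *s z) = 1" using normalize[OF zz] .
  define x where "x = c *s z"
  have x: "B x x = 1" "B x p = 0" "x \<in> L" using c zp z sub by (simp_all add: x_def vec.subspace_scale)
  have "x \<notin> vec.span {p}"
  proof
    assume "x \<in> vec.span {p}"
    then obtain d where "x = d *s p" using in_span_singleton by blast
    then have "B x x = fnorm d * B p p" using B_scale_self by simp
    then show False using x pp by simp
  qed
  then have "vec.dim (insert x {p}) = 2" using p by (simp only: vec.dim_insert) simp
  then have "vec.dim (vec.span {p, x}) = 2" by (simp add: insert_commute)
  moreover have "vec.span {p, x} \<subseteq> L" using sub pL x by (intro vec.span_minimal) auto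
  ultimately have Lspan: "L = vec.span {p, x}"
    using vec.subspace_dim_equal[OF vec.subspace_span sub, of "{p, x}"] dim by simp
  have "points_of L - {P} = punctured_line p x"
  proof (intro equalityI subsetI)
    fix X assume X: "X \<in> points_of L - {P}"
    then obtain w where w: "w \<noteq> 0" "w \<in> L" "X = vec.span {w}" using points_of_iff[OF sub] by blast
    then obtain a b where ab: "w = a *s p + b *s x" using Lspan in_span_pair by blast
    have "b \<noteq> 0"
    proof
      assume "b = 0"
      then have "w = a *s p" "a \<noteq> 0" using ab w by auto
      then have "P = X" unfolding p(1) w(3) using span_singleton_eq_iff[OF p(2)] by blast
      then show False using X by blast
    qed
    have "x + (a / b) *s p = (1 / b) *s w"
      unfolding ab using \<open>b \<noteq> 0\<close> by (simp add: vec.scale_right_distrib)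
    moreover have "1 / b \<noteq> 0" using \<open>b \<noteq> 0\<close> by simp
    ultimately have "X = vec.span {x + (a / b) *s p}"
      unfolding w(3) using span_singleton_eq_iff[OF w(1)] by blast
    then show "X \<in> punctured_line p x" by (simp add: punctured_line_def)
  next
    fix X assume "X \<in> punctured_line p x"
    then obtain a where a: "X = vec.span {x + a *s p}" by (auto simp: punctured_line_def)
    have B1: "B (x + a *s p) (x + a *s p) = 1" using x pp B_sym[of p x] by simp
    then have "x + a *s p \<noteq> 0" using nonzero_if_B by (metis one_neq_zero)
    moreover have "x + a *s p \<in> L" using x pL sub by (simp add: vec.subspace_add vec.subspace_scale)
    ultimately have "X \<in> points_of L" unfolding a using points_of_iff[OF sub] by blast
    moreover have "X \<notin> hermitian_variety B"
      unfolding a point_in_hermitian_variety_iff[OF \<open>x + a *s p \<noteq> 0\<close>] B1 by simp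
    ultimately show "X \<in> points_of L - {P}" using P by blast
  qed
  then show thesis using that x Lspan by blast
qed

lemma punctured_line_param:
  assumes x: "B x x = 1" "B x p = 0" and p: "B p p = 0" "p \<noteq> 0"
  shows "B (x + a *s p) (x + a *s p) = 1"
    and "inj (\<lambda>a. vec.span {x + a *s p})"
    and "card (punctured_line p x) = q ^ 2"
    and "punctured_line p x \<subseteq> pverts (NU_graph B)"
proof -
  show norm: "B (x + a *s p) (x + a *s p) = 1" for a using x p B_sym[of p x] by simp
  show inj: "inj (\<lambda>a. vec.span {x + a *s p})"
  proof (rule injI)
    fix a b assume eq: "vec.span {x + a *s p} = vec.span {x + b *s p}"
    have "x + a *s p \<noteq> 0" using norm nonzero_if_B by (metis one_neq_zero)
    then obtain c where c: "x + b *s p = c *s (x + a *s p)" using eq span_singleton_eq_iff by blast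
    have "B (x + d *s p) x = 1" for d using x B_sym[of p x] by simp
    then have "1 = c * 1" using arg_cong[OF c, of "\<lambda>z. B z x"] by (simp only: B_left(2))
    then have "b *s p = a *s p" using c by simp
    then show "a = b" using p by simp
  qed
  then show "card (punctured_line p x) = q ^ 2" by (simp add: punctured_line_def card_image card_field)
  show "punctured_line p x \<subseteq> pverts (NU_graph B)"
  proof
    fix X assume "X \<in> punctured_line p x"
    then obtain a where "X = vec.span {x + a *s p}" by (auto simp: punctured_line_def)
    then show "X \<in> pverts (NU_graph B)" using norm NU_vertex_iff by blast
  qed
qed

text \<open>
By \<open>NU_adjacent_iff\<close>, \<open>\<langle>w\<rangle>\<close> is adjacent to \<open>\<langle>x + a p\<rangle>\<close> iff \<open>B w x + conjugate a * B w p\<close> has field norm \<open>1\<close>.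
If \<open>B w p \<noteq> 0\<close>, this element runs through the whole field, otherwise it does not depend on \<open>a\<close>.
\<close>

lemma card_neighbours_in_punctured_line:
  assumes x: "B x x = 1" "B x p = 0" and p: "B p p = 0" "p \<noteq> 0"
    and w: "B w w = 1" "vec.span {w} \<notin> punctured_line p x"
  shows "B w p \<noteq> 0 \<Longrightarrow> card (neighbourhood (NU_graph B) (vec.span {w}) \<inter> punctured_line p x) = q + 1"
    and "B w p = 0 \<Longrightarrow> fnorm (B w x) = 1 \<Longrightarrow> punctured_line p x \<subseteq> neighbourhood (NU_graph B) (vec.span {w})"
    and "B w p = 0 \<Longrightarrow> fnorm (B w x) \<noteq> 1 \<Longrightarrow> neighbourhood (NU_graph B) (vec.span {w}) \<inter> punctured_line p x = {}"
proof -
  let ?N = "neighbourhood (NU_graph B) (vec.span {w})" and ?f = "\<lambda>a. vec.span {x + a *s p}"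
  have adj: "?f a \<in> ?N \<longleftrightarrow> fnorm (B w x + conjugate a * B w p) = 1" for a
  proof -
    have "vec.span {w} \<noteq> ?f a" using w(2) by (auto simp: punctured_line_def)
    then show ?thesis using NU_adjacent_iff[OF w(1) punctured_line_param(1)[OF x p]] by simp
  qed
  then have N: "?N \<inter> punctured_line p x = ?f ` {a. fnorm (B w x + conjugate a * B w p) = 1}"
    unfolding punctured_line_def by auto
  show "card (?N \<inter> punctured_line p x) = q + 1" if wp: "B w p \<noteq> 0"
  proof -
    have "card (?N \<inter> punctured_line p x) = card {a. fnorm (B w x + conjugate a * B w p) = 1}"
      unfolding N by (rule card_image) (rule inj_on_subset[OF punctured_line_param(2)[OF x p]], simp)
    also have "\<dots> = card {t. fnorm (B w x + t) = 1}"
      by (rule bij_betw_same_card[OF bij_betw_byWitness[where f = "\<lambda>a. conjugate a * B w p"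
            and f' = "\<lambda>t. conjugate (t / B w p)"]]) (use wp in auto)
    finally show ?thesis by (simp add: card_norm_translate)
  qed
  show "punctured_line p x \<subseteq> ?N" if "B w p = 0" "fnorm (B w x) = 1"
    using adj that by (auto simp: punctured_line_def)
  show "?N \<inter> punctured_line p x = {}" if "B w p = 0" "fnorm (B w x) \<noteq> 1"
    unfolding N using that by simp
qed

lemma card_neighbours_own_punctured_line:
  assumes x: "B x x = 1" "B x p = 0" and p: "B p p = 0" "p \<noteq> 0" and X: "X \<in> punctured_line p x"
  shows "card (neighbourhood (NU_graph B) X \<inter> punctured_line p x) = q ^ 2 - 1"
proof -
  obtain a where a: "X = vec.span {x + a *s p}" using X by (auto simp: punctured_line_def)
  have "Y \<in> neighbourhood (NU_graph B) X" if "Y \<in> punctured_line p x" "Y \<noteq> X" for Y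
  proof -
    obtain b where b: "Y = vec.span {x + b *s p}" using \<open>Y \<in> punctured_line p x\<close> by (auto simp: punctured_line_def)
    have "fnorm (B (x + a *s p) (x + b *s p)) = 1" using x p B_sym[of p x] by simp
    then show ?thesis
      using NU_adjacent_iff[OF punctured_line_param(1)[OF x p] punctured_line_param(1)[OF x p], of a b] that a b by simp
  qed
  moreover have "X \<notin> neighbourhood (NU_graph B) X" using pair_graph_NU pair_graph_iff by fastforce
  ultimately have "neighbourhood (NU_graph B) X \<inter> punctured_line p x = punctured_line p x - {X}" by blast
  then show ?thesis using X punctured_line_param(3)[OF x p] by (simp add: card_Diff_singleton)
qed

lemma punctured_lines_disjoint:
  assumes ne: "vec.span {p, x} \<noteq> vec.span {p, y}"
  shows "punctured_line p x \<inter> punctured_line p y = {}"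
proof -
  have sub: "vec.span {p, x} \<subseteq> vec.span {p, y}"
    if "vec.span {x + a *s p} = vec.span {y + b *s p}" for x y a b
  proof -
    have "x + a *s p \<in> vec.span {y + b *s p}" using that vec.span_base[of "x + a *s p" "{x + a *s p}"] by simp
    then obtain c where "x + a *s p = c *s (y + b *s p)" using in_span_singleton by blast
    then have "x = c *s (y + b *s p) - a *s p" by (simp add: eq_diff_eq)
    also have "\<dots> = (c * b - a) *s p + c *s y"
      by (simp add: vec.scale_right_distrib vec.scale_left_diff_distrib)
    finally have "x = (c * b - a) *s p + c *s y" .
    then have "x \<in> vec.span {p, y}" using in_span_pair by blast
    moreover have "p \<in> vec.span {p, y}" by (simp add: vec.span_base)
    ultimately show ?thesis by (intro vec.span_minimal) auto
  qed
  show ?thesis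
  proof (rule ccontr)
    assume "punctured_line p x \<inter> punctured_line p y \<noteq> {}"
    then obtain a b where "vec.span {x + a *s p} = vec.span {y + b *s p}" unfolding punctured_line_def by blast
    then show False using sub[of x a y b] sub[of y b x a] ne by simp
  qed
qed

text \<open>
Each of the two punctured lines is a clique of size \<open>q\<^sup>2\<close>, and between the two cliques there are all or no edges, according to
the field norm of \<open>B x y\<close>, where \<open>x\<close> and \<open>y\<close> have norm \<open>1\<close> and span the two lines together with \<open>p\<close>.
\<close>

proposition strongly_regular_switched_NU_graph:
  assumes srg: "strongly_regular (NU_graph B) v k lam mu" and mu: "mu > 0"
    and P: "P \<in> hermitian_variety B"
    and L1: "proj_line L1" "points_of L1 \<inter> hermitian_variety B = {P}"
    and L2: "proj_line L2" "points_of L2 \<inter> hermitian_variety B = {P}"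
    and ne: "L1 \<noteq> L2"
  shows "strongly_regular (switched_graph (NU_graph B) (points_of L1 - {P}) (points_of L2 - {P})) v k lam mu"
proof -
  let ?G = "NU_graph B"
  have "proj_point P" using P by (simp add: hermitian_variety_def)
  then obtain p where p: "p \<noteq> 0" "P = vec.span {p}" using proj_point_iff by blast
  then have pp: "B p p = 0" using P point_in_hermitian_variety_iff by blast
  obtain x where x: "B x x = 1" "B x p = 0" "L1 = vec.span {p, x}" "points_of L1 - {P} = punctured_line p x"
    using isotropic_line_param[OF L1 p(2,1)] .
  obtain y where y: "B y y = 1" "B y p = 0" "L2 = vec.span {p, y}" "points_of L2 - {P} = punctured_line p y"
    using isotropic_line_param[OF L2 p(2,1)] .
  note px = x(1,2) pp p(1) and py = y(1,2) pp p(1)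
  have disj: "punctured_line p x \<inter> punctured_line p y = {}"
    using punctured_lines_disjoint[of p x y] ne x(3) y(3) by simp
  define j where "j = (if fnorm (B x y) = 1 then q ^ 2 else 0)"
  have other: "card (neighbourhood ?G X \<inter> punctured_line p y) = (if fnorm (B x y) = 1 then q ^ 2 else 0)"
    if X: "X \<in> punctured_line p x" and disj: "punctured_line p x \<inter> punctured_line p y = {}"
      and x: "B x x = 1" "B x p = 0" and y: "B y y = 1" "B y p = 0" for X x y
  proof -
    obtain a where a: "X = vec.span {x + a *s p}" using X by (auto simp: punctured_line_def)
    have "vec.span {x + a *s p} \<notin> punctured_line p y" using X a disj by blast
    note * = card_neighbours_in_punctured_line[OF y pp p(1) punctured_line_param(1)[OF x pp p(1)] this]
    have Bp: "B (x + a *s p) p = 0" and By: "B (x + a *s p) y = B x y" using x y pp B_sym[of p y] by simp_all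
    show ?thesis
      using *(2,3)[OF Bp, unfolded By] punctured_line_param(3)[OF y pp p(1)] unfolding a
      by (cases "fnorm (B x y) = 1") (simp_all add: Int_absorb1)
  qed
  have "strongly_regular (switched_graph ?G (punctured_line p x) (punctured_line p y)) v k lam mu"
  proof (rule strongly_regular_switched_graph[OF srg mu, where m = "q ^ 2" and i = "q ^ 2 - 1" and j = j])
    show "punctured_line p x \<subseteq> pverts ?G" "punctured_line p y \<subseteq> pverts ?G"
      "card (punctured_line p x) = q ^ 2" "card (punctured_line p y) = q ^ 2"
      using punctured_line_param(3,4)[OF px] punctured_line_param(3,4)[OF py] by simp_all
    show "punctured_line p x \<inter> punctured_line p y = {}" by (rule disj)
    show "0 < q ^ 2" by simp
    show "card (neighbourhood ?G u \<inter> punctured_line p x) = q ^ 2 - 1 \<and> card (neighbourhood ?G u \<inter> punctured_line p y) = j"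
      if "u \<in> punctured_line p x" for u
      using card_neighbours_own_punctured_line[OF px that] other[OF that disj x(1,2) y(1,2)] by (simp add: j_def)
    have "fnorm (B y x) = fnorm (B x y)" using B_sym[of y x] by simp
    then show "card (neighbourhood ?G u \<inter> punctured_line p y) = q ^ 2 - 1 \<and> card (neighbourhood ?G u \<inter> punctured_line p x) = j"
      if "u \<in> punctured_line p y" for u
      using card_neighbours_own_punctured_line[OF py that] other[OF that _ y(1,2) x(1,2)] disj
      by (simp add: j_def Int_commute)
    fix W assume W: "W \<in> pverts ?G" "W \<notin> punctured_line p x \<union> punctured_line p y"
    then obtain w where w: "B w w = 1" "W = vec.span {w}" using NU_vertex_iff by blast
    have notin: "vec.span {w} \<notin> punctured_line p x" "vec.span {w} \<notin> punctured_line p y" using W w by auto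
    note Nx = card_neighbours_in_punctured_line[OF px w(1) notin(1)]
    note Ny = card_neighbours_in_punctured_line[OF py w(1) notin(2)]
    let ?N = "neighbourhood ?G W"
    show "card (?N \<inter> punctured_line p x) = card (?N \<inter> punctured_line p y) \<or>
      punctured_line p x \<subseteq> ?N \<and> ?N \<inter> punctured_line p y = {} \<or> punctured_line p y \<subseteq> ?N \<and> ?N \<inter> punctured_line p x = {}"
    proof (cases "B w p = 0")
      case False
      then show ?thesis using Nx(1) Ny(1) w(2) by simp
    next
      case True
      consider "fnorm (B w x) = 1" "fnorm (B w y) = 1" | "fnorm (B w x) = 1" "fnorm (B w y) \<noteq> 1"
        | "fnorm (B w x) \<noteq> 1" "fnorm (B w y) = 1" | "fnorm (B w x) \<noteq> 1" "fnorm (B w y) \<noteq> 1" by blast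
      then show ?thesis
      proof cases
        case 1
        then have "?N \<inter> punctured_line p x = punctured_line p x" "?N \<inter> punctured_line p y = punctured_line p y"
          using Nx(2) Ny(2) True w(2) by auto
        then show ?thesis using punctured_line_param(3)[OF px] punctured_line_param(3)[OF py] by simp
      qed (use Nx(2,3) Ny(2,3) True w(2) in auto)
    qed
  qed
  then show ?thesis using x(4) y(4) by simp
qed

lemma NU_parameters:
  assumes n: "n \<ge> 2"
  defines "\<epsilon> \<equiv> (-1 :: real) ^ (n + 1)"
  shows "num_norm (Suc n) / (real q + 1) = real q ^ n * (real q ^ (n + 1) - \<epsilon>) / (real q + 1)"
    and "num_isotropic n - 1 = (real q ^ n + \<epsilon>) * (real q ^ (n - 1) - \<epsilon>)"
    and "num_isotropic n - (real q ^ 2 - 1) * real q ^ (2 * n - 3) + real q * real q ^ (2 * n - 3) - 2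
      = real q ^ (2 * n - 3) * (real q + 1) - \<epsilon> * real q ^ (n - 1) * (real q - 1) - 2"
    and "(real q + 1) * num_norm (n - 1) = real q ^ (n - 2) * (real q + 1) * (real q ^ (n - 1) - \<epsilon>)"
proof -
  define m where "m = n - 2"
  have n': "n = Suc (Suc m)" using n by (auto simp: m_def)
  have e2: "\<epsilon> * \<epsilon> = 1" unfolding \<epsilon>_def by (simp flip: power_add)
  have em: "(-1) ^ m = - \<epsilon>" unfolding \<epsilon>_def n' by simp
  have pow: "real q ^ (m + m) = real q ^ m * real q ^ m"
    "real q ^ (m * 2) = real q ^ m * real q ^ m"
    by (simp_all add: mult_2_right power_add)
  have pow3: "real q ^ (2 * n - 3) = real q ^ m * real q ^ m * real q"
  proof -
    have "2 * n - 3 = m + m + 1" using n' by simp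
    then show ?thesis by (simp only: power_add power_one_right)
  qed
  define Q where "Q = real q ^ m"
  have iso: "num_isotropic n = real q ^ 3 * Q * Q - \<epsilon> * (real q - 1) * real q * Q"
    unfolding num_isotropic_def n' Q_def using em by (simp add: power3_eq_cube pow field_simps)
  have norm1: "num_norm (Suc n) = real q ^ 5 * Q * Q - \<epsilon> * real q ^ 2 * Q"
    unfolding num_norm_def n' Q_def using em by (simp add: eval_nat_numeral pow field_simps)
  have norm2: "num_norm (n - 1) = real q * Q * Q - \<epsilon> * Q"
    unfolding num_norm_def n' Q_def using em by (simp add: eval_nat_numeral pow field_simps)
  show "num_norm (Suc n) / (real q + 1) = real q ^ n * (real q ^ (n + 1) - \<epsilon>) / (real q + 1)"
    unfolding norm1 unfolding n' by (simp add: Q_def eval_nat_numeral algebra_simps)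
  show "num_isotropic n - 1 = (real q ^ n + \<epsilon>) * (real q ^ (n - 1) - \<epsilon>)"
    unfolding iso unfolding n' using e2 by (simp add: Q_def eval_nat_numeral algebra_simps)
  show "num_isotropic n - (real q ^ 2 - 1) * real q ^ (2 * n - 3) + real q * real q ^ (2 * n - 3) - 2
      = real q ^ (2 * n - 3) * (real q + 1) - \<epsilon> * real q ^ (n - 1) * (real q - 1) - 2"
    unfolding iso pow3 unfolding n' by (simp add: Q_def eval_nat_numeral algebra_simps)
  show "(real q + 1) * num_norm (n - 1) = real q ^ (n - 2) * (real q + 1) * (real q ^ (n - 1) - \<epsilon>)"
    unfolding norm2 unfolding n' by (simp add: Q_def eval_nat_numeral algebra_simps)
qed

text \<open>
The three numbers are obtained from the closed formulas, which are non-negative integers; this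
avoids exhibiting a pair of adjacent and a pair of non-adjacent vertices.
\<close>

lemma NU_parameters_natural:
  assumes n: "n \<ge> 2"
  obtains k lam mu :: nat where
    "real k = num_isotropic n - 1" and
    "real lam = num_isotropic n - (real q ^ 2 - 1) * real q ^ (2 * n - 3) + real q * real q ^ (2 * n - 3) - 2" and
    "real mu = (real q + 1) * num_norm (n - 1)"
proof -
  define \<epsilon> where "\<epsilon> = (-1 :: real) ^ (n + 1)"
  note parameters = NU_parameters[OF n, folded \<epsilon>_def]
  have eps: "\<epsilon> \<in> \<int>" "\<bar>\<epsilon>\<bar> = 1" by (simp_all add: \<epsilon>_def power_abs)
  have nat: "\<exists>m::nat. r = real m" if "r \<in> \<int>" "r \<ge> 0" for r :: real
    using that by (metis Ints_cases nonneg_int_cases of_int_0_le_iff of_int_of_nat_eq)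
  have q: "real q \<ge> 2" using q_ge_2 by simp
  have pow: "real q ^ i \<ge> 1" for i using q by simp
  have "num_isotropic n - 1 \<ge> 0"
    unfolding parameters(2) using pow[of n] pow[of "n - 1"] eps(2)
    by (intro mult_nonneg_nonneg) linarith+
  moreover have "num_isotropic n - 1 \<in> \<int>" unfolding parameters(2) using eps(1) by simp
  moreover have "(real q + 1) * num_norm (n - 1) \<ge> 0"
    using num_norm_pos[of "n - 1"] n by (intro mult_nonneg_nonneg) auto
  moreover have "(real q + 1) * num_norm (n - 1) \<in> \<int>" unfolding parameters(4) using eps(1) by simp
  moreover have "real q ^ (2 * n - 3) * (real q + 1) - \<epsilon> * real q ^ (n - 1) * (real q - 1) - 2 \<in> \<int>"
    using eps(1) by simp
  moreover have "real q ^ (2 * n - 3) * (real q + 1) - \<epsilon> * real q ^ (n - 1) * (real q - 1) - 2 \<ge> 0"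
  proof -
    have "real q ^ (n - 1) \<le> real q ^ (2 * n - 3)" using q n by (intro power_increasing) auto
    then have "real q ^ (n - 1) * (real q - 1) \<le> real q ^ (2 * n - 3) * (real q - 1)"
      using q by (intro mult_right_mono) auto
    moreover have "\<epsilon> * (real q ^ (n - 1) * (real q - 1)) \<le> 1 * (real q ^ (n - 1) * (real q - 1))"
      using eps(2) q by (intro mult_right_mono mult_nonneg_nonneg) auto
    ultimately show ?thesis using pow[of "2 * n - 3"] by (simp add: algebra_simps)
  qed
  ultimately obtain k mu lam :: nat where
    "num_isotropic n - 1 = real k" "(real q + 1) * num_norm (n - 1) = real mu"
    "real q ^ (2 * n - 3) * (real q + 1) - \<epsilon> * real q ^ (n - 1) * (real q - 1) - 2 = real lam"
    using nat by meson
  then show thesis using that[of k lam mu] parameters(3) by simp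
qed

end

section \<open>The switched graphs\<close>

theorem theorem4p4:
  fixes q n :: nat
    and B :: "'a::{field,finite} ^ 'n \<Rightarrow> 'a ^ 'n \<Rightarrow> 'a"
    and P L1 L2 :: "('a ^ 'n) set"
  assumes "primepow q" and "n \<ge> 4"
    and "CARD('a) = q ^ 2" and "CARD('n) = n + 1"
    and "nondegenerate_hermitian_form q B"
    and "P \<in> hermitian_variety B"
    and "proj_line L1" and "proj_line L2" and "L1 \<noteq> L2"
    and "points_of L1 \<inter> hermitian_variety B = {P}"
    and "points_of L2 \<inter> hermitian_variety B = {P}"
  shows
    "let \<epsilon> = (-1 :: real) ^ (n + 1);
         G = NU_graph B;
         l1 = points_of L1 - {P};
         l2 = points_of L2 - {P};
         S = points_of (proj_join L1 L2) \<inter> hermitian_variety B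
     in \<exists>v k lam mu :: nat.
          real v = real q ^ n * (real q ^ (n + 1) - \<epsilon>) / (real q + 1) \<and>
          real k = (real q ^ n + \<epsilon>) * (real q ^ (n - 1) - \<epsilon>) \<and>
          real lam = real q ^ (2 * n - 3) * (real q + 1) - \<epsilon> * real q ^ (n - 1) * (real q - 1) - 2 \<and>
          real mu = real q ^ (n - 2) * (real q + 1) * (real q ^ (n - 1) - \<epsilon>) \<and>
          strongly_regular G v k lam mu \<and>
          (hermitian_pencil q S \<longrightarrow> strongly_regular (switched_graph G l1 l2) v k lam mu) \<and>
          ((\<exists>M. proj_line M \<and> S = points_of M) \<longrightarrow>
             strongly_regular (switched_graph G l1 l2) v k lam mu)"
proof -
  interpret hermitian_space q B
    using assms by unfold_locales
  have n: "CARD('n) = Suc n" "n \<ge> 2" using assms by auto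
  define \<epsilon> where "\<epsilon> = (-1 :: real) ^ (n + 1)"
  note parameters = NU_parameters[OF n(2), folded \<epsilon>_def]
  define v where "v = card (pverts (NU_graph B))"
  have v: "(real q + 1) * real v = num_norm (Suc n)"
    unfolding v_def by (rule card_NU_vertices[OF n(1)])
  have v': "real v = real q ^ n * (real q ^ (n + 1) - \<epsilon>) / (real q + 1)"
    unfolding parameters(1)[symmetric] v[symmetric] by simp
  obtain k lam mu :: nat where
    k: "real k = num_isotropic n - 1" and
    lam: "real lam = num_isotropic n - (real q ^ 2 - 1) * real q ^ (2 * n - 3) + real q * real q ^ (2 * n - 3) - 2" and
    mu: "real mu = (real q + 1) * num_norm (n - 1)"
    using NU_parameters_natural[OF n(2)] .
  have srg: "strongly_regular (NU_graph B) v k lam mu"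
    by (rule strongly_regular_NU_graph[OF n v k lam mu])
  have "real mu > 0" unfolding mu using num_norm_pos[of "n - 1"] n(2) by (intro mult_pos_pos) auto
  then have "mu > 0" by simp
  then have switched:
    "strongly_regular (switched_graph (NU_graph B) (points_of L1 - {P}) (points_of L2 - {P})) v k lam mu"
    using strongly_regular_switched_NU_graph[OF srg] assms by blast
  show ?thesis
    unfolding Let_def \<epsilon>_def[symmetric]
    by (intro exI[of _ v] exI[of _ k] exI[of _ lam] exI[of _ mu] conjI impI
        v' k[unfolded parameters(2)] lam[unfolded parameters(3)] mu[unfolded parameters(4)] srg switched)
qed

end
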